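(* Let $\theta_0\in\,]0,\pi/2[$, $0<\alpha<1$, $c>0$, and let $I:[0,\infty)\to[0,1]$ be non-decreasing. Then the optimization problem (OP2) has at least one optimal solution.
   Context: Model 2 (stem with variable length and variable leaf density, parameterized by arc-length $t$). For $\theta\in[\theta_0,\pi/2]$ and $u\ge0$ let $$G(\theta,u)=\Big(1-\exp\Big\{\frac{-u}{\cos(\theta-\theta_0)}\Big\}\Big)\cos(\theta-\theta_0).$$ An admissible control is a pair of measurable functions $\theta:[0,\infty)\to[\theta_0,\pi/2]$ and $u:[0,\infty)\to[0,\infty)$ with $u\in L^1([0,\infty))$. Its state is $y(t)=\int_0^t\sin\theta(s)\,ds$ (height) and $z(t)=\int_t^\infty u(s)\,ds$. Problem (OP2), for a non-decreasing light intensity $I:[0,\infty)\to[0,1]$ and constants $0<\alpha<1$, $c>0$: maximize over admissible $(\theta,u)$ $$J(\theta,u)=\int_0^\infty\Big[I(y(t))\,G(\theta(t),u(t))-c\,z(t)^\alpha\Big]dt\in[-\infty,\infty).$$ An optimal solution is an admissible pair attaining the supremum. *)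

theory Defs
  imports "HOL-Analysis.Analysis"
begin

definition G2 :: "real \<Rightarrow> real \<Rightarrow> real \<Rightarrow> real" where
  "G2 \<theta>0 \<theta> u = (1 - exp (- u / cos (\<theta> - \<theta>0))) * cos (\<theta> - \<theta>0)"

definition admissible2 :: "real \<Rightarrow> (real \<Rightarrow> real) \<Rightarrow> (real \<Rightarrow> real) \<Rightarrow> bool" where
  "admissible2 \<theta>0 \<theta> u \<longleftrightarrow>
     \<theta> \<in> borel_measurable (restrict_space lebesgue {0..}) \<and>
     u \<in> borel_measurable (restrict_space lebesgue {0..}) \<and>
     (\<forall>t\<ge>0. \<theta>0 \<le> \<theta> t \<and> \<theta> t \<le> pi / 2) \<and>
     (\<forall>t\<ge>0. 0 \<le> u t) \<and>
     set_integrable lebesgue {0..} u"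

definition height2 :: "(real \<Rightarrow> real) \<Rightarrow> real \<Rightarrow> real" where
  "height2 \<theta> t = (LINT s:{0..t}|lebesgue. sin (\<theta> s))"

definition zstate2 :: "(real \<Rightarrow> real) \<Rightarrow> real \<Rightarrow> real" where
  "zstate2 u t = (LINT s:{t..}|lebesgue. u s)"

definition payoff2 :: "real \<Rightarrow> real \<Rightarrow> real \<Rightarrow> (real \<Rightarrow> real) \<Rightarrow>
    (real \<Rightarrow> real) \<Rightarrow> (real \<Rightarrow> real) \<Rightarrow> real \<Rightarrow> real" where
  "payoff2 \<theta>0 \<alpha> c I \<theta> u t =
     I (height2 \<theta> t) * G2 \<theta>0 (\<theta> t) (u t) - c * (zstate2 u t) powr \<alpha>"

text \<open>The functional J, valued in the extended reals: integral of the positive part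
  minus integral of the negative part (the positive part is always finite for
  admissible controls, so J is in [-inf, inf)).\<close>
definition J2 :: "real \<Rightarrow> real \<Rightarrow> real \<Rightarrow> (real \<Rightarrow> real) \<Rightarrow>
    (real \<Rightarrow> real) \<Rightarrow> (real \<Rightarrow> real) \<Rightarrow> ereal" where
  "J2 \<theta>0 \<alpha> c I \<theta> u =
     enn2ereal (\<integral>\<^sup>+ t\<in>{0..}. ennreal (max 0 (payoff2 \<theta>0 \<alpha> c I \<theta> u t)) \<partial>lebesgue)
     - enn2ereal (\<integral>\<^sup>+ t\<in>{0..}. ennreal (max 0 (- payoff2 \<theta>0 \<alpha> c I \<theta> u t)) \<partial>lebesgue)"

definition optimal2 :: "real \<Rightarrow> real \<Rightarrow> real \<Rightarrow> (real \<Rightarrow> real) \<Rightarrow>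
    (real \<Rightarrow> real) \<Rightarrow> (real \<Rightarrow> real) \<Rightarrow> bool" where
  "optimal2 \<theta>0 \<alpha> c I \<theta> u \<longleftrightarrow>
     admissible2 \<theta>0 \<theta> u \<and>
     J2 \<theta>0 \<alpha> c I \<theta> u =
       (SUP p\<in>{(\<theta>', u'). admissible2 \<theta>0 \<theta>' u'}. J2 \<theta>0 \<alpha> c I (fst p) (snd p))"

end

theory Submission
  imports Defs "HOL-Complex_Analysis.Great_Picard"
begin

text \<open>
  Written in \<open>w = sin \<theta>\<close>, the gain \<open>G\<close> is the perspective of \<open>1 - exp (- u)\<close> evaluated at the concave
  function \<open>cos (\<theta> - \<theta>0) = cos \<theta>0 sqrt (1 - w\<^sup>2) + sin \<theta>0 w\<close>, hence jointly concave in \<open>(w, u)\<close>.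

  Truncating the density at a fixed integrable cap \<open>m(t) \<ge> ln (T / t)\<close> that vanishes for \<open>t > T\<close>
  does not decrease the payoff when \<open>T\<close> is large: removing \<open>g = (u - m)\<^sup>+\<close> costs at most
  \<open>min 1 (t / T) min 1 g(t)\<close> at time \<open>t\<close>, while the cost of transport drops by a multiple of
  \<open>min (\<integral>\<^sub>t\<^sup>\<infinity> g) T\<close>, and Tonelli compares the two integrals.

  For capped controls on \<open>[0, T]\<close> the states of a maximising sequence converge uniformly along a
  subsequence (Arzela-Ascoli). Heights are strictly increasing, so the discontinuities of \<open>I\<close> are
  met on a null set and \<open>I(y\<^sub>n)\<close> may be replaced by \<open>I(y)\<close>. With the weight \<open>I(y)\<close> frozen, the
  controls whose states are close to the limit and whose weighted gain is almost maximal form a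
  decreasing sequence of convex sets; near-minimisers of the \<open>L\<^sup>2\<close> norm in these sets converge
  almost everywhere, and the limit is optimal.
\<close>

subsection \<open>Concavity\<close>

lemma abs_midpoint_le:
  fixes p q r d :: real
  assumes "\<bar>p - r\<bar> \<le> d" "\<bar>q - r\<bar> \<le> d"
  shows "\<bar>(p + q) / 2 - r\<bar> \<le> d"
  using assms by (auto simp: abs_le_iff field_simps)

lemma le_of_midpoint_le:
  fixes p q r x :: real
  assumes "x \<le> p" "x \<le> q" "(p + q) / 2 \<le> r"
  shows "x \<le> r"
  using add_mono[OF assms(1,2)] assms(3) by simp

text \<open>\<open>G2\<close> with \<open>cos (\<theta> - \<theta>0)\<close> replaced by a free
  variable \<open>k\<close>: the perspective of \<open>1 - exp (- x)\<close>.\<close>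

definition light :: "real \<Rightarrow> real \<Rightarrow> real" where
  "light k u = k * (1 - exp (- u / k))"

text \<open>Convexity of \<open>exp\<close> with weights \<open>k / (k + l)\<close> and
  \<open>l / (k + l)\<close>. Since \<open>light\<close> is homogeneous of degree one,
  superadditivity amounts to joint concavity; monotonicity in \<open>k\<close> and the midpoint
  inequality are both read off from it.\<close>

lemma light_superadditive:
  assumes "0 < k" "0 < l"
  shows "light k u + light l v \<le> light (k + l) (u + v)"
proof -
  have c: "convex_on UNIV (exp :: real \<Rightarrow> real)" by (rule exp_convex)
  have "exp ((1 - l / (k + l)) *\<^sub>R (- u / k) + (l / (k + l)) *\<^sub>R (- v / l))
      \<le> (1 - l / (k + l)) * exp (- u / k) + l / (k + l) * exp (- v / l)"
    by (rule convex_onD[OF c]) (use assms in auto)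
  moreover have "(1 - l / (k + l)) *\<^sub>R (- u / k) + (l / (k + l)) *\<^sub>R (- v / l) = - (u + v) / (k + l)"
    using assms by (simp add: divide_simps)
  ultimately have "exp (- (u + v) / (k + l)) \<le> (1 - l / (k + l)) * exp (- u / k) + l / (k + l) * exp (- v / l)"
    by simp
  then have "(k + l) * exp (- (u + v) / (k + l))
      \<le> (k + l) * ((1 - l / (k + l)) * exp (- u / k) + l / (k + l) * exp (- v / l))"
    using assms by (intro mult_left_mono) auto
  also have "\<dots> = k * exp (- u / k) + l * exp (- v / l)"
    using assms by (simp add: divide_simps)
  finally show ?thesis
    by (simp add: light_def algebra_simps)
qed

text \<open>Superadditivity with the extra summand \<open>light (l - k) 0 = 0\<close>.\<close>

lemma light_mono_left:
  assumes "0 < k" "k \<le> l"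
  shows "light k u \<le> light l u"
  using light_superadditive[of k "l - k" u 0] assms
  by (cases "k = l") (auto simp: light_def)

lemma light_midpoint:
  assumes "0 < k" "0 < l"
  shows "(light k u + light l v) / 2 \<le> light ((k + l) / 2) ((u + v) / 2)"
proof -
  have "- ((u + v) / 2) / ((k + l) / 2) = - (u + v) / (k + l)"
    using assms by (simp add: divide_simps) (simp add: algebra_simps)
  then have "light ((k + l) / 2) ((u + v) / 2) = light (k + l) (u + v) / 2"
    unfolding light_def by simp
  then show ?thesis using light_superadditive[OF assms, of u v] by simp
qed

lemma light_nonneg: "0 < k \<Longrightarrow> 0 \<le> u \<Longrightarrow> 0 \<le> light k u"
  by (simp add: light_def)

lemma light_le_left: "0 < k \<Longrightarrow> light k u \<le> k"
  by (simp add: light_def)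

lemma light_le_right:
  assumes "0 < k"
  shows "light k u \<le> u"
proof -
  have "1 - u / k \<le> exp (- u / k)" using exp_ge_add_one_self[of "- u / k"] by simp
  then have "k * (1 - exp (- u / k)) \<le> k * (u / k)" using assms by (intro mult_left_mono) auto
  then show ?thesis using assms by (simp add: light_def)
qed

text \<open>The increment factors exactly as \<open>exp (- v / k) * light k g\<close>: leaves
  already present attenuate whatever the additional ones can gain. With \<open>v\<close> at the cap,
  the exponential becomes the small factor \<open>t / T\<close>.\<close>

lemma light_increment:
  assumes "0 < k" "k \<le> 1" "0 \<le> v" "0 \<le> g"
  shows "light k (v + g) - light k v \<le> exp (- v) * min 1 g"
proof -
  have "light k (v + g) - light k v = exp (- v / k) * light k g"
    by (simp add: light_def algebra_simps exp_add[symmetric] add_divide_distrib diff_divide_distrib)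
  also have "\<dots> \<le> exp (- v) * min 1 g"
  proof (intro mult_mono)
    have "v * k \<le> v" using assms by (simp add: mult_left_le)
    then show "exp (- v / k) \<le> exp (- v)" using assms by (simp add: field_simps)
    show "light k g \<le> min 1 g"
      using assms light_le_left[of k g] light_le_right[of k g] by auto
  qed (use assms light_nonneg in auto)
  finally show ?thesis .
qed

text \<open>After squaring this says that two points \<open>(a, p)\<close> and \<open>(b, q)\<close>
  of the unit circle have inner product at most \<open>1\<close>.\<close>

lemma sqrt_one_minus_square_midpoint:
  fixes a b :: real
  assumes "0 \<le> a" "a \<le> 1" "0 \<le> b" "b \<le> 1"
  shows "(sqrt (1 - a\<^sup>2) + sqrt (1 - b\<^sup>2)) / 2 \<le> sqrt (1 - ((a + b) / 2)\<^sup>2)"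
proof (rule real_le_rsqrt)
  define p q where "p = sqrt (1 - a\<^sup>2)" "q = sqrt (1 - b\<^sup>2)"
  have "a\<^sup>2 \<le> 1" "b\<^sup>2 \<le> 1" using assms by (auto simp: power_le_one)
  then have pq: "p\<^sup>2 = 1 - a\<^sup>2" "q\<^sup>2 = 1 - b\<^sup>2" by (auto simp: p_q_def)
  have "0 \<le> (a - b)\<^sup>2 + (p - q)\<^sup>2" by simp
  then have "a * b + p * q \<le> 1" using pq by (simp add: power2_eq_square algebra_simps)
  then show "((sqrt (1 - a\<^sup>2) + sqrt (1 - b\<^sup>2)) / 2)\<^sup>2 \<le> 1 - ((a + b) / 2)\<^sup>2"
    using pq unfolding p_q_def[symmetric] by (simp add: power2_eq_square field_simps)
qed

text \<open>By concavity the chord is at least as steep as the tangent at the right end point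
  \<open>x + d\<close>, and that tangent is at least as steep as the one at
  \<open>K\<close>.\<close>

lemma powr_increment_ge:
  fixes x d a K :: real
  assumes "0 \<le> x" "0 \<le> d" "x + d \<le> K" "0 < a" "a < 1"
  shows "a * K powr (a - 1) * d \<le> (x + d) powr a - x powr a"
proof (cases "d = 0")
  case False
  define s where "s = x + d"
  have s: "0 < s" using assms False by (simp add: s_def)
  have "x powr a \<le> s powr a - a * s powr (a - 1) * d"
  proof (cases "x = 0")
    case True
    then have "s powr (a - 1) * d = s powr a" using s by (simp add: s_def powr_mult_base[symmetric] mult.commute powr_diff)
    then show ?thesis using True assms s by (simp add: mult.assoc)
  next
    case x: False
    \<comment> \<open>Young's inequality with weights \<open>a\<close> and \<open>1 - a\<close>,
      divided by \<open>s powr (1 - a)\<close>, is the tangent line inequality at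
      \<open>s\<close>.\<close>
    have "x powr a * s powr (1 - a) \<le> a * x + (1 - a) * s"
      using assms s x by (intro Youngs_inequality_0) auto
    then have "(x powr a * s powr (1 - a)) * s powr (a - 1) \<le> (a * x + (1 - a) * s) * s powr (a - 1)"
      by (intro mult_right_mono) auto
    moreover have "s powr (1 - a) * s powr (a - 1) = 1"
      using s by (simp add: powr_add[symmetric])
    moreover have "s * s powr (a - 1) = s powr a"
      using s powr_mult_base[of s "a - 1"] by simp
    moreover have "a * x + (1 - a) * s = s - a * d" by (simp add: s_def algebra_simps)
    ultimately show ?thesis by (simp add: mult.assoc) (simp add: algebra_simps)
  qed
  moreover have "K powr (a - 1) \<le> s powr (a - 1)"
    using s assms by (intro powr_mono2') (auto simp: s_def)
  then have "a * K powr (a - 1) * d \<le> a * s powr (a - 1) * d"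
    using assms by (intro mult_right_mono mult_left_mono) auto
  ultimately show ?thesis by (simp add: s_def)
qed simp

subsection \<open>Almost everywhere convergence from convexity\<close>

text \<open>Geometric decay of the increments in \<open>L^2\<close> gives almost everywhere
  convergence of the sequence itself, so that no further subsequence has to be extracted.\<close>

lemma (in finite_measure) AE_summable_of_fast_L2:
  fixes d :: "nat \<Rightarrow> 'a \<Rightarrow> real"
  assumes [measurable]: "\<And>k. d k \<in> borel_measurable M"
    and int: "\<And>k. integrable M (\<lambda>x. (d k x)\<^sup>2)"
    and le: "\<And>k. (\<integral>x. (d k x)\<^sup>2 \<partial>M) \<le> K * (1 / 4) ^ k"
  shows "AE x in M. summable (\<lambda>k. \<bar>d k x\<bar>)"
proof -
  have "0 \<le> (\<integral>x. (d 0 x)\<^sup>2 \<partial>M)" by simp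
  then have K: "0 \<le> K" using order_trans[OF _ le[of 0]] by simp
  \<comment> \<open>Integrating \<open>|d| \<le> 2\<^sup>-\<^sup>k + 2\<^sup>k d\<^sup>2\<close> bounds the \<open>L\<^sup>1\<close> norms by a geometric sequence.\<close>
  have pt: "\<bar>y\<bar> \<le> (1/2)^k + 2^k * y\<^sup>2" for y :: real and k :: nat
  proof -
    have "0 \<le> (1/2)^k * ((2^k * \<bar>y\<bar> - 1)\<^sup>2 + 2^k * \<bar>y\<bar>)" by simp
    also have "\<dots> = (1/2)^k + ((1/2)^k * 2^k) * (2^k * y\<^sup>2) - ((1/2)^k * 2^k) * \<bar>y\<bar>"
      by (simp add: power2_eq_square algebra_simps abs_mult_self)
    also have "(1/2::real)^k * 2^k = 1" by (simp add: power_mult_distrib[symmetric])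
    finally show ?thesis by simp
  qed
  have nn: "(\<integral>\<^sup>+x. ennreal \<bar>d k x\<bar> \<partial>M) \<le> ennreal ((measure M (space M) + K) * (1/2)^k)" for k
  proof -
    have i: "integrable M (\<lambda>x. (1/2)^k + 2^k * (d k x)\<^sup>2)" using int by simp
    have "(\<integral>\<^sup>+x. ennreal \<bar>d k x\<bar> \<partial>M) \<le> (\<integral>\<^sup>+x. ennreal ((1/2)^k + 2^k * (d k x)\<^sup>2) \<partial>M)"
      by (intro nn_integral_mono ennreal_leI pt)
    also have "\<dots> = ennreal (\<integral>x. (1/2)^k + 2^k * (d k x)\<^sup>2 \<partial>M)"
      using i by (intro nn_integral_eq_integral) auto
    also have "(\<integral>x. (1/2)^k + 2^k * (d k x)\<^sup>2 \<partial>M) = (1/2)^k * measure M (space M) + 2^k * (\<integral>x. (d k x)\<^sup>2 \<partial>M)"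
      using int by simp
    also have "\<dots> \<le> (1/2)^k * measure M (space M) + 2^k * (K * (1/4)^k)"
      using le by (intro add_left_mono mult_left_mono) auto
    also have "\<dots> = (measure M (space M) + K) * (1/2)^k"
    proof -
      have "(2::real)^k * (1/4)^k = (1/2)^k" by (simp add: power_mult_distrib[symmetric])
      then have "2^k * (K * (1/4)^k) = K * (1/2)^k" by (metis mult.assoc mult.commute)
      then show ?thesis by (simp add: algebra_simps)
    qed
    finally show ?thesis by (simp add: ennreal_leI)
  qed
  have "(\<integral>\<^sup>+x. (\<Sum>k. ennreal \<bar>d k x\<bar>) \<partial>M) = (\<Sum>k. \<integral>\<^sup>+x. ennreal \<bar>d k x\<bar> \<partial>M)"
    by (rule nn_integral_suminf) simp
  also have "\<dots> \<le> (\<Sum>k. ennreal ((measure M (space M) + K) * (1/2)^k))"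
    by (intro suminf_le nn) auto
  also have "\<dots> = ennreal (\<Sum>k. (measure M (space M) + K) * (1/2)^k)"
    using K by (intro suminf_ennreal2) (auto intro: summable_mult)
  finally have "(\<integral>\<^sup>+x. (\<Sum>k. ennreal \<bar>d k x\<bar>) \<partial>M) \<noteq> \<infinity>" by (auto simp: top_unique)
  then have "AE x in M. (\<Sum>k. ennreal \<bar>d k x\<bar>) \<noteq> \<infinity>"
    by (intro nn_integral_PInf_AE) auto
  then show ?thesis
    by eventually_elim (auto intro: summable_suminf_not_top)
qed

text \<open>Near-minimisers of the \<open>L\<^sup>2\<close> norm over a decreasing sequence of midpoint-closed sets form a
  Cauchy sequence by the parallelogram law.\<close>
lemma (in finite_measure) midpoint_closed_AE_convergent:
  fixes C :: "nat \<Rightarrow> ('a \<Rightarrow> 'b::euclidean_space) set" and h :: "'a \<Rightarrow> real"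
  assumes dec: "decseq C" and ne: "\<And>n. C n \<noteq> {}"
    and mid: "\<And>n f g. f \<in> C n \<Longrightarrow> g \<in> C n \<Longrightarrow> (\<lambda>x. (1/2) *\<^sub>R (f x + g x)) \<in> C n"
    and meas: "\<And>n f. f \<in> C n \<Longrightarrow> f \<in> borel_measurable M"
    and bd: "\<And>n f x. f \<in> C n \<Longrightarrow> x \<in> space M \<Longrightarrow> (norm (f x))\<^sup>2 \<le> h x"
    and h: "integrable M h"
  obtains g G where "\<And>n. g n \<in> C n" "G \<in> borel_measurable M"
    "AE x in M. (\<lambda>n. g n x) \<longlonglongrightarrow> G x"
proof -
  define \<phi> where "\<phi> f = (\<integral>x. (norm (f x))\<^sup>2 \<partial>M)" for f :: "'a \<Rightarrow> 'b"
  define a where "a n = (INF f\<in>C n. \<phi> f)" for n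
  have int: "integrable M (\<lambda>x. (norm (f x))\<^sup>2)" if "f \<in> C n" for f n
    using h
  proof (rule Bochner_Integration.integrable_bound)
    show "(\<lambda>x. (norm (f x))\<^sup>2) \<in> borel_measurable M" using meas[OF that] by measurable
    show "AE x in M. norm ((norm (f x))\<^sup>2) \<le> norm (h x)"
      using bd[OF that] by (intro AE_I2) (force intro: order_trans[OF _ abs_ge_self])
  qed
  have nn: "0 \<le> \<phi> f" for f by (simp add: \<phi>_def)
  have bdd: "bdd_below (\<phi> ` C n)" for n using nn by (intro bdd_belowI[of _ 0]) auto
  have a_le: "a n \<le> \<phi> f" if "f \<in> C n" for f n
    unfolding a_def using bdd that by (intro cINF_lower)
  have a_inc: "incseq a"
    unfolding incseq_def a_def using bdd ne dec
    by (auto intro!: cINF_superset_mono dest: decseqD)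
  have a_ub: "a n \<le> (\<integral>x. h x \<partial>M)" for n
  proof -
    obtain f where f: "f \<in> C n" using ne by blast
    have "a n \<le> \<phi> f" using a_le f .
    also have "\<dots> \<le> (\<integral>x. h x \<partial>M)" unfolding \<phi>_def
      using int[OF f] h bd[OF f] by (intro integral_mono) auto
    finally show ?thesis .
  qed
  obtain L where L: "a \<longlonglongrightarrow> L" and aL: "\<And>n. a n \<le> L"
    using incseq_convergent[OF a_inc, of "\<integral>x. h x \<partial>M"] a_ub by blast
  \<comment> \<open>The index \<open>r k\<close> is taken so late that the infimum there is within
    \<open>(1/4)^k\<close> of the limit \<open>L\<close>; then \<open>g k\<close> is chosen in
    \<open>C (r k)\<close> with norm at most that far above \<open>L\<close>.\<close>
  have "\<exists>n\<ge>k. L - (1/4)^k < a n" for k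
  proof -
    have "L - (1/4)^k < L" by simp
    from order_tendstoD(1)[OF L this] show ?thesis
      by (metis eventually_sequentially max.cobounded1 max.cobounded2)
  qed
  then obtain r where r: "\<And>k. r k \<ge> k" "\<And>k. L - (1/4)^k < a (r k)" by metis
  have "\<exists>f\<in>C (r k). \<phi> f < L + (1/4)^k" for k
  proof -
    have "a (r k) < L + (1/4)^k" by (rule le_less_trans[OF aL]) simp
    then show ?thesis unfolding a_def using bdd ne by (subst (asm) cINF_less_iff) auto
  qed
  then obtain g where g: "\<And>k. g k \<in> C (r k)" "\<And>k. \<phi> (g k) < L + (1/4)^k" by metis
  have [measurable]: "g k \<in> borel_measurable M" for k using meas g(1) .
  have d: "(\<integral>x. (norm (g (Suc k) x - g k x))\<^sup>2 \<partial>M) \<le> 8 * (1/4)^k"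
    and di: "integrable M (\<lambda>x. (norm (g (Suc k) x - g k x))\<^sup>2)" for k
  proof -
    \<comment> \<open>The indices \<open>r k\<close> need not increase. The smaller of two
      consecutive ones gives a set containing both functions, hence also their midpoint.\<close>
    define p where "p = min (r k) (r (Suc k))"
    have gp: "g k \<in> C p" "g (Suc k) \<in> C p"
      using g(1)[of k] g(1)[of "Suc k"] decseqD[OF dec, of p "r k"] decseqD[OF dec, of p "r (Suc k)"]
      by (auto simp: p_def)
    define f where "f x = (1/2) *\<^sub>R (g (Suc k) x + g k x)" for x
    have fC: "f \<in> C p" using mid[OF gp(2) gp(1)] by (simp add: f_def[abs_def])
    \<comment> \<open>Parallelogram law. The errors \<open>2\<close>, \<open>2\<close> and
      \<open>4\<close> times \<open>(1/4)^k\<close> in its three terms add up to the constant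
      \<open>8\<close> below.\<close>
    have eq: "(norm (g (Suc k) x - g k x))\<^sup>2
        = 2 * (norm (g (Suc k) x))\<^sup>2 + 2 * (norm (g k x))\<^sup>2 - 4 * (norm (f x))\<^sup>2" for x
      by (simp add: f_def power2_norm_eq_inner inner_simps inner_commute algebra_simps)
    note ints = int[OF gp(1)] int[OF gp(2)] int[OF fC]
    show "integrable M (\<lambda>x. (norm (g (Suc k) x - g k x))\<^sup>2)"
      unfolding eq using ints by auto
    have "(\<integral>x. (norm (g (Suc k) x - g k x))\<^sup>2 \<partial>M) = 2 * \<phi> (g (Suc k)) + 2 * \<phi> (g k) - 4 * \<phi> f"
      unfolding eq \<phi>_def using ints by simp
    moreover have q: "(1/4::real)^Suc k \<le> (1/4)^k" by simp
    moreover have "L - (1/4)^k < a (r (Suc k))" using r(2)[of "Suc k"] q by linarith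
    then have "L - (1/4)^k < a p" using r(2)[of k] by (simp add: p_def min_def)
    moreover note a_le[OF fC] g(2)[of k] g(2)[of "Suc k"]
    ultimately show "(\<integral>x. (norm (g (Suc k) x - g k x))\<^sup>2 \<partial>M) \<le> 8 * (1/4)^k" by linarith
  qed
  have "AE x in M. summable (\<lambda>k. \<bar>norm (g (Suc k) x - g k x)\<bar>)"
    by (rule AE_summable_of_fast_L2[where K = 8]) (use d di in auto)
  then have "AE x in M. (\<lambda>n. g n x) \<longlonglongrightarrow> lim (\<lambda>n. g n x)"
  proof eventually_elim
    case (elim x)
    then have "summable (\<lambda>k. g (Suc k) x - g k x)" by (simp add: summable_norm_cancel)
    then have "convergent (\<lambda>n. \<Sum>k<n. g (Suc k) x - g k x)" by (simp add: summable_iff_convergent)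
    then have "convergent (\<lambda>n. g n x - g 0 x)"
      by (simp only: sum_lessThan_telescope[of "\<lambda>n. g n x"])
    then have "convergent (\<lambda>n. g n x)" by (simp add: convergent_diff_const_right_iff)
    then show ?case by (simp add: convergent_LIMSEQ_iff)
  qed
  moreover have "g n \<in> C n" for n using g(1)[of n] decseqD[OF dec r(1)[of n]] by auto
  ultimately show thesis by (intro that[of g "\<lambda>x. lim (\<lambda>n. g n x)"]) auto
qed

subsection \<open>Tail integrals\<close>

text \<open>The indicators of the half-lines converge at every point other than \<open>s\<close>,
  and \<open>\<bar>g\<bar>\<close> dominates. This is sequential continuity of tail
  integrals.\<close>

lemma tail_integral_tendsto:
  fixes g :: "real \<Rightarrow> real"
  assumes g: "integrable lebesgue g" and t: "t \<longlonglongrightarrow> s"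
  shows "(\<lambda>n. LINT x:{t n..}|lebesgue. g x) \<longlonglongrightarrow> (LINT x:{s..}|lebesgue. g x)"
  unfolding set_lebesgue_integral_def
proof (rule integral_dominated_convergence[where w = "\<lambda>x. \<bar>g x\<bar>"])
  have [measurable]: "g \<in> borel_measurable lebesgue" using g by simp
  show "(\<lambda>x. indicator {s..} x *\<^sub>R g x) \<in> borel_measurable lebesgue"
    by (intro borel_measurable_integrable integrable_mult_indicator[OF _ g]) simp
  show "(\<lambda>x. indicator {t n..} x *\<^sub>R g x) \<in> borel_measurable lebesgue" for n
    by (intro borel_measurable_integrable integrable_mult_indicator[OF _ g]) simp
  have "AE x in lebesgue. x \<noteq> s"
    by (rule AE_I[where N = "{s}"]) auto
  then show "AE x in lebesgue. (\<lambda>n. indicator {t n..} x *\<^sub>R g x) \<longlonglongrightarrow> indicator {s..} x *\<^sub>R g x"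
  proof eventually_elim
    case (elim x)
    then consider "s < x" | "x < s" by linarith
    then have "\<forall>\<^sub>F n in sequentially. indicator {t n..} x = (indicator {s..} x :: real)"
    proof cases
      case 1
      from order_tendstoD(2)[OF t 1] show ?thesis by eventually_elim (use 1 in auto)
    next
      case 2
      from order_tendstoD(1)[OF t 2] show ?thesis by eventually_elim (use 2 in auto)
    qed
    then show ?case by (intro tendsto_eventually) (auto elim: eventually_mono)
  qed
qed (use g in \<open>auto simp: indicator_def\<close>)

lemma tail_integral_tendsto_0:
  fixes g :: "real \<Rightarrow> real"
  assumes g: "integrable lebesgue g"
  shows "(\<lambda>n. LINT x:{real n..}|lebesgue. g x) \<longlonglongrightarrow> 0"
proof -
  have [measurable]: "g \<in> borel_measurable lebesgue" using g by simp
  have "(\<lambda>n. LINT x|lebesgue. indicator {real n..} x *\<^sub>R g x) \<longlonglongrightarrow> (LINT (x::real)|lebesgue. (0::real))"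
  proof (rule integral_dominated_convergence[where w = "\<lambda>x. \<bar>g x\<bar>"])
    show "(\<lambda>x. indicator {real n..} x *\<^sub>R g x) \<in> borel_measurable lebesgue" for n
      by (intro borel_measurable_integrable integrable_mult_indicator[OF _ g]) simp
    show "AE x in lebesgue. (\<lambda>n. indicator {real n..} x *\<^sub>R g x) \<longlonglongrightarrow> 0"
    proof (intro AE_I2 tendsto_eventually)
      fix x :: real
      have "\<forall>\<^sub>F n in sequentially. x < real n"
        using filterlim_real_sequentially by (simp add: filterlim_at_top_dense)
      then show "\<forall>\<^sub>F n in sequentially. indicator {real n..} x *\<^sub>R g x = 0"
        by eventually_elim auto
    qed
  qed (use g in \<open>auto simp: indicator_def\<close>)
  then show ?thesis by (simp add: set_lebesgue_integral_def)
qed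

lemma nn_tail_integral:
  fixes g :: "real \<Rightarrow> real"
  assumes g: "integrable lebesgue g" and nn: "\<And>x. 0 \<le> g x"
  shows "(\<integral>\<^sup>+x. ennreal (g x) * indicator {t..} x \<partial>lebesgue) = ennreal (LINT x:{t..}|lebesgue. g x)"
proof -
  have "integrable lebesgue (\<lambda>x. indicator {t..} x *\<^sub>R g x)"
    using g by (intro integrable_mult_indicator) auto
  then have "ennreal (LINT x:{t..}|lebesgue. g x) = (\<integral>\<^sup>+x. ennreal (indicator {t..} x *\<^sub>R g x) \<partial>lebesgue)"
    unfolding set_lebesgue_integral_def using nn by (intro nn_integral_eq_integral[symmetric]) auto
  also have "\<dots> = (\<integral>\<^sup>+x. ennreal (g x) * indicator {t..} x \<partial>lebesgue)"
    by (intro nn_integral_cong) (auto simp: indicator_def)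
  finally show ?thesis by simp
qed

lemma nn_integral_lborel_Fubini:
  fixes f :: "real \<times> real \<Rightarrow> ennreal"
  assumes "f \<in> borel_measurable (lborel \<Otimes>\<^sub>M lborel)"
  shows "(\<integral>\<^sup>+x. \<integral>\<^sup>+y. f (x, y) \<partial>lborel \<partial>lborel) = (\<integral>\<^sup>+y. \<integral>\<^sup>+x. f (x, y) \<partial>lborel \<partial>lborel)"
  using lborel_pair.Fubini[OF assms] by simp

text \<open>Beyond the time \<open>\<tau>\<close> at which the tail integral \<open>D\<close> drops below \<open>T\<close>, Tonelli turns \<open>\<integral> t g(t) dt\<close>
  into \<open>\<integral> \<integral>\<^bsub>max s \<tau>\<^esub>\<^bsup>\<infinity>\<^esup> g ds\<close>; before \<open>\<tau>\<close> the integrand is at most \<open>1 = min D T / T\<close>.\<close>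
lemma truncation_loss_le:
  fixes g :: "real \<Rightarrow> real" and T :: real
  defines "D \<equiv> \<lambda>t. LINT s:{t..}|lebesgue. g s"
  assumes g: "integrable lebesgue g" and nn: "\<And>x. 0 \<le> g x" and T: "0 < T"
  shows "(\<integral>\<^sup>+t\<in>{0..}. ennreal (min 1 (t / T) * min 1 (g t)) \<partial>lebesgue)
      \<le> ennreal (2 / T) * (\<integral>\<^sup>+t\<in>{0..}. ennreal (min (D t) T) \<partial>lebesgue)"
proof -
  have [measurable]: "g \<in> borel_measurable lebesgue" using g by simp
  have [measurable]: "(\<lambda>x::real. x) \<in> borel_measurable lebesgue" by (simp add: measurable_completion)
  have Ddec: "D t \<le> D s" if "s \<le> t" for s t
    unfolding D_def set_lebesgue_integral_def
    using g nn that by (intro integral_mono integrable_mult_indicator) (auto simp: indicator_def)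
  have Dborel: "D \<in> borel_measurable borel"
  proof -
    have "mono (\<lambda>t. - D t)" using Ddec by (auto simp: mono_def)
    then have "(\<lambda>t. - D t) \<in> borel_measurable borel" by (rule borel_measurable_mono)
    then show ?thesis by (rule borel_measurable_uminus_eq[THEN iffD1])
  qed
  have [measurable]: "D \<in> borel_measurable lebesgue" using Dborel by (simp add: measurable_completion)
  define S where "S = {t. 0 \<le> t \<and> D t \<le> T}"
  define \<tau> where "\<tau> = Inf S"
  obtain n where "D (real n) < T"
    using order_tendstoD(2)[OF tail_integral_tendsto_0[OF g] T] by (auto simp: D_def eventually_sequentially)
  then have Sne: "S \<noteq> {}" by (auto simp: S_def intro!: exI[of _ "real n"])
  have Sbdd: "bdd_below S" by (rule bdd_belowI[of _ 0]) (simp add: S_def)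
  \<comment> \<open>Closedness puts the infimum \<open>\<tau>\<close> into \<open>S\<close>; as
    \<open>D\<close> is antitone, \<open>S\<close> is then the closed half-line from
    \<open>\<tau>\<close>.\<close>
  have "closed S"
    unfolding closed_sequential_limits
  proof (intro allI impI, elim conjE)
    fix x l assume x: "\<forall>n. x n \<in> S" "x \<longlonglongrightarrow> l"
    have "(\<lambda>n. D (x n)) \<longlonglongrightarrow> D l" unfolding D_def by (rule tail_integral_tendsto[OF g x(2)])
    then have "D l \<le> T" using x(1) by (intro LIMSEQ_le_const2) (auto simp: S_def)
    moreover have "0 \<le> l" using x by (intro LIMSEQ_le_const) (auto simp: S_def)
    ultimately show "l \<in> S" by (simp add: S_def)
  qed
  then have \<tau>S: "\<tau> \<in> S" unfolding \<tau>_def using Sne Sbdd by (intro closed_contains_Inf)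
  have S_eq: "S = {\<tau>..}"
  proof (intro set_eqI iffI)
    fix t assume "t \<in> S" then show "t \<in> {\<tau>..}" unfolding \<tau>_def using Sbdd by (simp add: cInf_lower)
  next
    fix t assume "t \<in> {\<tau>..}" then show "t \<in> S" using \<tau>S Ddec[of \<tau> t] by (auto simp: S_def)
  qed
  \<comment> \<open>Tonelli is applied to the product of two copies of \<open>lborel\<close>,
    whereas \<open>g\<close> is only Lebesgue measurable; a Borel representative takes its
    place.\<close>
  obtain g' where g'[measurable]: "g' \<in> borel_measurable lborel" and gg': "AE x in lborel. ennreal (g x) = g' x"
    using completion_ex_borel_measurable[of "\<lambda>x. ennreal (g x)" lborel] by auto
  have gg: "AE x in lebesgue. ennreal (g x) = g' x" using gg' by (rule AE_completion)
  have "(\<integral>\<^sup>+t\<in>{0..}. ennreal (min 1 (t / T) * min 1 (g t)) \<partial>lebesgue)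
     \<le> (\<integral>\<^sup>+t. ennreal (1/T) * (ennreal (min (D t) T) * indicator {0..} t)
          + ennreal (1/T) * (ennreal t * (ennreal (g t) * indicator {\<tau>..} t)) \<partial>lebesgue)"
  proof (rule nn_integral_mono)
    fix t :: real
    consider "t < 0" | "0 \<le> t" "t < \<tau>" | "\<tau> \<le> t" by linarith
    then show "ennreal (min 1 (t / T) * min 1 (g t)) * indicator {0..} t
       \<le> ennreal (1/T) * (ennreal (min (D t) T) * indicator {0..} t)
          + ennreal (1/T) * (ennreal t * (ennreal (g t) * indicator {\<tau>..} t))"
    proof cases
      case 2
      then have "t \<notin> S" by (simp add: S_eq)
      then have "min (D t) T = T" using 2 by (simp add: S_def)
      moreover have "min 1 (t / T) * min 1 (g t) \<le> 1"
        using 2 T nn[of t] by (intro mult_le_one) auto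
      ultimately show ?thesis using 2 T by (simp add: ennreal_mult[symmetric])
    next
      case 3
      then have "0 \<le> t" using \<tau>S by (simp add: S_def)
      moreover have "min 1 (t / T) * min 1 (g t) \<le> (t / T) * g t"
        using \<open>0 \<le> t\<close> T nn[of t] by (intro mult_mono) auto
      then have "ennreal (min 1 (t / T) * min 1 (g t)) \<le> ennreal (1/T) * (ennreal t * ennreal (g t))"
        using \<open>0 \<le> t\<close> T nn[of t] by (simp add: ennreal_mult[symmetric] ennreal_leI)
      ultimately show ?thesis using 3 by (simp add: add_increasing)
    qed auto
  qed
  also have "\<dots> = ennreal (1/T) * (\<integral>\<^sup>+t\<in>{0..}. ennreal (min (D t) T) \<partial>lebesgue)
     + ennreal (1/T) * (\<integral>\<^sup>+t. ennreal t * (ennreal (g t) * indicator {\<tau>..} t) \<partial>lebesgue)"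
    by (subst nn_integral_add, measurable, measurable) (subst nn_integral_cmult, measurable)+
  also have "(\<integral>\<^sup>+t. ennreal t * (ennreal (g t) * indicator {\<tau>..} t) \<partial>lebesgue)
     = (\<integral>\<^sup>+t. ennreal t * (g' t * indicator {\<tau>..} t) \<partial>lborel)"
  proof -
    have "(\<integral>\<^sup>+t. ennreal t * (ennreal (g t) * indicator {\<tau>..} t) \<partial>lebesgue)
        = (\<integral>\<^sup>+t. ennreal t * (g' t * indicator {\<tau>..} t) \<partial>lebesgue)"
      using gg by (intro nn_integral_cong_AE) (auto elim!: eventually_mono)
    also have "\<dots> = (\<integral>\<^sup>+t. ennreal t * (g' t * indicator {\<tau>..} t) \<partial>lborel)"
      by (subst nn_integral_completion) auto
    finally show ?thesis .
  qed
  \<comment> \<open>The factor \<open>t\<close> is written as the length of \<open>{0..t}\<close>,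
    which creates the second variable to interchange.\<close>
  also have "\<dots> = (\<integral>\<^sup>+t. \<integral>\<^sup>+s. indicator {0..t} s * (g' t * indicator {\<tau>..} t) \<partial>lborel \<partial>lborel)"
  proof (rule nn_integral_cong)
    fix t :: real
    show "ennreal t * (g' t * indicator {\<tau>..} t) = (\<integral>\<^sup>+s. indicator {0..t} s * (g' t * indicator {\<tau>..} t) \<partial>lborel)"
      using \<tau>S by (cases "0 \<le> t") (auto simp: nn_integral_multc S_def ennreal_neg)
  qed
  also have "\<dots> = (\<integral>\<^sup>+t. \<integral>\<^sup>+s. (if 0 \<le> s \<and> s \<le> t \<and> \<tau> \<le> t then g' t else 0) \<partial>lborel \<partial>lborel)"
    by (intro nn_integral_cong) (auto simp: indicator_def)
  also have "\<dots> = (\<integral>\<^sup>+s. \<integral>\<^sup>+t. (if 0 \<le> s \<and> s \<le> t \<and> \<tau> \<le> t then g' t else 0) \<partial>lborel \<partial>lborel)"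
    by (rule nn_integral_lborel_Fubini[of "\<lambda>(t, s). if 0 \<le> s \<and> s \<le> t \<and> \<tau> \<le> t then g' t else 0", simplified]) measurable
  also have "\<dots> = (\<integral>\<^sup>+s. \<integral>\<^sup>+t. g' t * indicator {max s \<tau>..} t * indicator {0..} s \<partial>lborel \<partial>lborel)"
    by (intro nn_integral_cong) (auto simp: indicator_def)
  also have "\<dots> \<le> (\<integral>\<^sup>+s. ennreal (min (D s) T) * indicator {0..} s \<partial>lborel)"
  proof (rule nn_integral_mono)
    fix s :: real
    have "(\<integral>\<^sup>+t. g' t * indicator {max s \<tau>..} t \<partial>lborel) = (\<integral>\<^sup>+t. g' t * indicator {max s \<tau>..} t \<partial>lebesgue)"
      by (subst nn_integral_completion) auto
    also have "\<dots> = (\<integral>\<^sup>+t. ennreal (g t) * indicator {max s \<tau>..} t \<partial>lebesgue)"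
      using gg by (intro nn_integral_cong_AE) (auto elim!: eventually_mono)
    also have "\<dots> = ennreal (D (max s \<tau>))"
      unfolding D_def by (rule nn_tail_integral[OF g nn])
    also have "\<dots> \<le> ennreal (min (D s) T)"
    proof -
      \<comment> \<open>Starting at \<open>max s \<tau>\<close> makes the tail at most
        \<open>D s\<close> by monotonicity and at most \<open>T\<close> by the choice of
        \<open>\<tau>\<close>.\<close>
      have "max s \<tau> \<in> S" by (simp add: S_eq)
      then show ?thesis using Ddec[of s "max s \<tau>"] by (intro ennreal_leI) (auto simp: S_def)
    qed
    finally show "(\<integral>\<^sup>+t. g' t * indicator {max s \<tau>..} t * indicator {0..} s \<partial>lborel) \<le> ennreal (min (D s) T) * indicator {0..} s"
      by (auto simp: indicator_def)
  qed
  also have "\<dots> = (\<integral>\<^sup>+s\<in>{0..}. ennreal (min (D s) T) \<partial>lebesgue)"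
    using Dborel by (subst nn_integral_completion) auto
  finally have "(\<integral>\<^sup>+t\<in>{0..}. ennreal (min 1 (t / T) * min 1 (g t)) \<partial>lebesgue)
     \<le> ennreal (1/T) * (\<integral>\<^sup>+t\<in>{0..}. ennreal (min (D t) T) \<partial>lebesgue)
       + ennreal (1/T) * (\<integral>\<^sup>+t\<in>{0..}. ennreal (min (D t) T) \<partial>lebesgue)"
    by (simp add: add_left_mono mult_left_mono)
  also have "\<dots> = ennreal (2 / T) * (\<integral>\<^sup>+t\<in>{0..}. ennreal (min (D t) T) \<partial>lebesgue)"
    using T by (simp add: distrib_right[symmetric] ennreal_plus[symmetric] del: ennreal_plus)
  finally show ?thesis .
qed

subsection \<open>Reduction to capped controls\<close>

text \<open>Extension by zero carries Borel measurability on \<open>A\<close> over to the completed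
  measure.\<close>

lemma mono_on_measurable_lebesgue_on:
  fixes f :: "real \<Rightarrow> real"
  assumes "mono_on A f" and A: "A \<in> sets borel"
  shows "f \<in> borel_measurable (lebesgue_on A)"
proof -
  have "f \<in> borel_measurable (restrict_space borel A)" using assms by (intro borel_measurable_mono_on_fnc)
  then have "(\<lambda>x. if x \<in> A then f x else 0) \<in> borel_measurable borel"
    using A by (subst (asm) measurable_restrict_space_iff[where c = 0]) auto
  then have "(\<lambda>x. if x \<in> A then f x else 0) \<in> borel_measurable lebesgue"
    by (simp add: measurable_completion)
  then show ?thesis using A by (subst measurable_restrict_space_iff[where c = 0]) auto
qed

lemma J2_eq_restrict:
  "J2 \<theta>0 \<alpha> c I \<theta> u =
     enn2ereal (\<integral>\<^sup>+ t. ennreal (max 0 (payoff2 \<theta>0 \<alpha> c I \<theta> u t)) \<partial>(lebesgue_on {0..}))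
     - enn2ereal (\<integral>\<^sup>+ t. ennreal (max 0 (- payoff2 \<theta>0 \<alpha> c I \<theta> u t)) \<partial>(lebesgue_on {0..}))"
  by (simp add: J2_def nn_integral_restrict_space)

lemma enn2ereal_pos_part_minus_neg_part:
  assumes "integrable M f"
  shows "enn2ereal (\<integral>\<^sup>+ x. ennreal (max 0 (f x)) \<partial>M) - enn2ereal (\<integral>\<^sup>+ x. ennreal (max 0 (- f x)) \<partial>M)
    = ereal (integral\<^sup>L M f)"
proof -
  have fin: "(\<integral>\<^sup>+ x. ennreal (f x) \<partial>M) \<noteq> \<infinity>" "(\<integral>\<^sup>+ x. ennreal (- f x) \<partial>M) \<noteq> \<infinity>"
    using assms by (auto simp: real_integrable_def)
  have m: "ennreal (max 0 y) = ennreal y" for y by (simp add: max_def ennreal_neg)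
  show ?thesis
    unfolding m using fin by (cases "\<integral>\<^sup>+ x. ennreal (f x) \<partial>M"; cases "\<integral>\<^sup>+ x. ennreal (- f x) \<partial>M")
      (auto simp: real_lebesgue_integral_def[OF assms] enn2real_def)
qed

text \<open>In terms of \<open>w = sin \<theta>\<close> this is \<open>cos (\<theta> - \<theta>0)\<close>.\<close>
definition slope :: "real \<Rightarrow> real \<Rightarrow> real" where
  "slope \<theta>0 w = cos \<theta>0 * sqrt (1 - w\<^sup>2) + sin \<theta>0 * w"

text \<open>Any integrable function that is at least \<open>ln (T / t)\<close> on \<open>(0, T]\<close> and vanishes beyond \<open>T\<close> would
  do as a cap on the leaf density; this one is moreover square integrable. At \<open>t = 0\<close> it takes the
  junk value \<open>0\<close>.\<close>
definition cap :: "real \<Rightarrow> real \<Rightarrow> real" where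
  "cap T t = (if t \<in> {0..T} then 4 * (T powr (1/4) * t powr (-1/4)) else 0)"

lemma cap_nonneg: "0 \<le> cap T t" by (simp add: cap_def)

lemma cap_outside: "t < 0 \<or> T < t \<Longrightarrow> cap T t = 0" by (auto simp: cap_def)

lemma powr_set_integrable:
  assumes "-1 < a" "0 \<le> T"
  shows "set_integrable lebesgue {0..T} (\<lambda>t::real. t powr a)"
    and "(LINT t:{0..T}|lebesgue. t powr a) = T powr (a + 1) / (a + 1)"
proof -
  note hi = has_integral_powr_from_0[OF assms]
  then show i: "set_integrable lebesgue {0..T} (\<lambda>t::real. t powr a)"
    by (intro nonnegative_absolutely_integrable_1) auto
  show "(LINT t:{0..T}|lebesgue. t powr a) = T powr (a + 1) / (a + 1)"
    using set_lebesgue_integral_eq_integral(2)[OF i] hi by (simp add: integral_unique)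
qed

lemma cap_integrable:
  assumes "0 < T"
  shows "integrable lebesgue (cap T)" "(\<integral>t. cap T t \<partial>lebesgue) = 16 / 3 * T"
proof -
  have eq: "cap T t = 4 * T powr (1/4) * (indicator {0..T} t *\<^sub>R t powr (-1/4))" for t
    by (simp add: cap_def)
  show "integrable lebesgue (cap T)"
    unfolding eq[abs_def] using powr_set_integrable(1)[of "-1/4" T] assms
    by (intro integrable_mult_right) (simp add: set_integrable_def)
  have "(\<integral>t. cap T t \<partial>lebesgue) = 4 * T powr (1/4) * (T powr (-1/4 + 1) / (-1/4 + 1))"
    unfolding eq[abs_def] using powr_set_integrable(2)[of "-1/4" T] assms
    by (simp add: set_lebesgue_integral_def)
  also have "\<dots> = 16 / 3 * (T powr (1/4) * T powr (3/4))" by simp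
  also have "T powr (1/4) * T powr (3/4) = T" using assms by (simp add: powr_add[symmetric])
  finally show "(\<integral>t. cap T t \<partial>lebesgue) = 16 / 3 * T" .
qed

lemma cap_square_integrable:
  assumes "0 < T"
  shows "integrable lebesgue (\<lambda>t. (cap T t)\<^sup>2)"
proof -
  have "t powr (-1/4) * t powr (-1/4) = t powr (-1/2)" for t :: real
    by (simp add: powr_add[symmetric])
  then have eq: "(cap T t)\<^sup>2 = 16 * (T powr (1/4))\<^sup>2 * (indicator {0..T} t *\<^sub>R t powr (-1/2))" for t
    by (simp add: cap_def power2_eq_square)
  show ?thesis
    unfolding eq[abs_def] using powr_set_integrable(1)[of "-1/2" T] assms
    by (intro integrable_mult_right) (simp add: set_integrable_def)
qed

text \<open>On \<open>(0, T]\<close> the cap is \<open>4 * x\<close> with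
  \<open>x = (T / t) powr (1/4)\<close>, and \<open>ln x \<le> x\<close> gives
  \<open>ln (T / t) = 4 * ln x \<le> 4 * x\<close>. Beyond \<open>T\<close> the cap is zero and both
  sides equal \<open>1\<close>.\<close>

lemma exp_minus_cap_le:
  assumes "0 < T" "0 < t"
  shows "exp (- cap T t) \<le> min 1 (t / T)"
proof (cases "t \<le> T")
  case True
  define x where "x = T powr (1/4) * t powr (-1/4)"
  have x: "0 < x" using assms by (simp add: x_def)
  have "ln x = (ln T - ln t) / 4" using assms by (simp add: x_def ln_mult ln_powr)
  moreover have "ln x \<le> x" using ln_bound[OF x] .
  ultimately have "- (4 * x) \<le> ln (t / T)" using assms by (simp add: ln_div)
  then have "exp (- (4 * x)) \<le> t / T" using assms by (simp add: ln_ge_iff)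
  moreover have "cap T t = 4 * x" using True assms by (simp add: cap_def x_def)
  ultimately show ?thesis using True assms x by simp
qed (use assms in \<open>auto simp: cap_def\<close>)

lemma slope_sin:
  assumes "0 < \<theta>0" "\<theta>0 \<le> \<theta>" "\<theta> \<le> pi / 2"
  shows "slope \<theta>0 (sin \<theta>) = cos (\<theta> - \<theta>0)"
proof -
  have "0 \<le> cos \<theta>" using assms by (intro cos_ge_zero) auto
  then have "sqrt (1 - (sin \<theta>)\<^sup>2) = cos \<theta>" by (simp add: cos_squared_eq[symmetric])
  then show ?thesis by (simp add: slope_def cos_diff)
qed

lemma sin_arcsin_control:
  assumes "0 < \<theta>0" "\<theta>0 < pi / 2" "sin \<theta>0 \<le> w" "w \<le> 1"
  shows "\<theta>0 \<le> arcsin w" "arcsin w \<le> pi / 2" "sin (arcsin w) = w"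
proof -
  have "0 < sin \<theta>0" using assms by (intro sin_gt_zero) auto
  then have w: "-1 \<le> w" using assms by simp
  show "sin (arcsin w) = w" using w assms by simp
  show "arcsin w \<le> pi / 2" using w assms arcsin_bounded by blast
  have "arcsin (sin \<theta>0) \<le> arcsin w"
    using assms \<open>0 < sin \<theta>0\<close> by (intro arcsin_le_arcsin) auto
  then show "\<theta>0 \<le> arcsin w" using assms by (simp add: arcsin_sin)
qed

lemma slope_bounds:
  assumes "0 < \<theta>0" "\<theta>0 < pi / 2" "sin \<theta>0 \<le> w" "w \<le> 1"
  shows "0 < slope \<theta>0 w" "slope \<theta>0 w \<le> 1"
proof -
  note a = sin_arcsin_control[OF assms]
  have eq: "slope \<theta>0 w = cos (arcsin w - \<theta>0)" using slope_sin[of \<theta>0 "arcsin w"] a assms by simp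
  show "slope \<theta>0 w \<le> 1" by (simp add: eq)
  show "0 < slope \<theta>0 w" unfolding eq using a assms by (intro cos_gt_zero_pi) auto
qed

text \<open>\<open>light\<close> is jointly concave and increasing in its first argument, so
  inserting the concave function \<open>slope \<theta>0\<close> preserves concavity.\<close>

lemma gain_midpoint:
  assumes "0 < \<theta>0" "\<theta>0 < pi / 2" "sin \<theta>0 \<le> a" "a \<le> 1" "sin \<theta>0 \<le> b" "b \<le> 1"
  shows "(light (slope \<theta>0 a) u + light (slope \<theta>0 b) v) / 2
    \<le> light (slope \<theta>0 ((a + b) / 2)) ((u + v) / 2)"
proof -
  have pos: "0 < slope \<theta>0 a" "0 < slope \<theta>0 b" using slope_bounds assms by auto
  have s: "0 < sin \<theta>0" "0 < cos \<theta>0" using assms by (auto intro!: sin_gt_zero cos_gt_zero)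
  have "(slope \<theta>0 a + slope \<theta>0 b) / 2
      = cos \<theta>0 * ((sqrt (1 - a\<^sup>2) + sqrt (1 - b\<^sup>2)) / 2) + sin \<theta>0 * ((a + b) / 2)"
    by (simp add: slope_def field_simps)
  also have "\<dots> \<le> slope \<theta>0 ((a + b) / 2)"
    unfolding slope_def
    using s assms by (intro add_right_mono mult_left_mono sqrt_one_minus_square_midpoint) auto
  finally have "light ((slope \<theta>0 a + slope \<theta>0 b) / 2) ((u + v) / 2) \<le> light (slope \<theta>0 ((a + b) / 2)) ((u + v) / 2)"
    using pos by (intro light_mono_left) auto
  then show ?thesis using light_midpoint[OF pos, of u v] by linarith
qed

lemma gain_tendsto:
  assumes "w \<longlonglongrightarrow> a" "u \<longlonglongrightarrow> v" "slope \<theta>0 a \<noteq> 0"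
  shows "(\<lambda>n. light (slope \<theta>0 (w n)) (u n)) \<longlonglongrightarrow> light (slope \<theta>0 a) v"
  using assms unfolding light_def slope_def by (intro tendsto_intros) auto

lemma gain_measurable:
  assumes [measurable]: "w \<in> borel_measurable M" "u \<in> borel_measurable M"
  shows "(\<lambda>t. light (slope \<theta>0 (w t)) (u t)) \<in> borel_measurable M"
  unfolding light_def slope_def by measurable

text \<open>The last assumption makes the marginal cost of leaves above the cap exceed their marginal gain:
  the constant multiplying \<open>T\<close> bounds the slope of \<open>c z\<^sup>\<alpha>\<close> for \<open>z \<le> 7 T\<close> from below, and the
  capped part of the density has mass at most \<open>6 T\<close>.\<close>
locale stem =
  fixes \<theta>0 \<alpha> c :: real and I :: "real \<Rightarrow> real" and T :: real
  assumes th0: "0 < \<theta>0" "\<theta>0 < pi / 2"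
    and al: "0 < \<alpha>" "\<alpha> < 1" and c0: "0 < c"
    and I01: "\<And>x. 0 \<le> x \<Longrightarrow> 0 \<le> I x" "\<And>x. 0 \<le> x \<Longrightarrow> I x \<le> 1"
    and Imono: "mono_on {0..} I"
    and T0: "0 < T" and T_large: "2 \<le> c * (\<alpha> * (7 * T) powr (\<alpha> - 1)) * T"
begin

section \<open>States, gain and cost in the variables \<open>w\<close> and \<open>u\<close>\<close>

definition height :: "(real \<Rightarrow> real) \<Rightarrow> real \<Rightarrow> real" where
  "height w t = (LINT s:{0..t}|lebesgue. w s)"

definition gain :: "(real \<Rightarrow> real) \<Rightarrow> (real \<Rightarrow> real) \<Rightarrow> real \<Rightarrow> real" where
  "gain w u t = light (slope \<theta>0 (w t)) (u t)"

definition cost :: "(real \<Rightarrow> real) \<Rightarrow> real \<Rightarrow> real" where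
  "cost u t = c * (zstate2 u t) powr \<alpha>"

text \<open>The bounds hold at every real time, negative ones included, so that controls are
  measurable for \<open>lebesgue\<close> itself rather than for a restriction of it.\<close>

definition incline :: "(real \<Rightarrow> real) \<Rightarrow> bool" where
  "incline w \<longleftrightarrow> w \<in> borel_measurable lebesgue \<and> (\<forall>t. sin \<theta>0 \<le> w t \<and> w t \<le> 1)"

definition density :: "(real \<Rightarrow> real) \<Rightarrow> bool" where
  "density u \<longleftrightarrow> integrable lebesgue u \<and> (\<forall>t. 0 \<le> u t)"

definition capped :: "(real \<Rightarrow> real) \<Rightarrow> bool" where
  "capped u \<longleftrightarrow> u \<in> borel_measurable lebesgue \<and> (\<forall>t. 0 \<le> u t \<and> u t \<le> cap T t)"

text \<open>Integration stops at \<open>T\<close> because a capped density vanishes afterwards, and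
  with it both the gain and the cost.\<close>

definition reduced_value :: "(real \<Rightarrow> real) \<Rightarrow> (real \<Rightarrow> real) \<Rightarrow> real" where
  "reduced_value w u =
     (\<integral>t. I (height w t) * gain w u t \<partial>lebesgue_on {0..T}) - (\<integral>t. cost u t \<partial>lebesgue_on {0..T})"

lemma sin_pos: "0 < sin \<theta>0"
  using th0 by (intro sin_gt_zero) auto

lemma inclineD:
  assumes "incline w"
  shows "w \<in> borel_measurable lebesgue" "sin \<theta>0 \<le> w t" "w t \<le> 1" "0 \<le> w t"
    "0 < slope \<theta>0 (w t)" "slope \<theta>0 (w t) \<le> 1"
proof -
  show a: "w \<in> borel_measurable lebesgue" "sin \<theta>0 \<le> w t" "w t \<le> 1" using assms by (auto simp: incline_def)
  show "0 \<le> w t" using a sin_pos by linarith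
  show "0 < slope \<theta>0 (w t)" "slope \<theta>0 (w t) \<le> 1" using slope_bounds[OF th0] a by auto
qed

lemma capped_density: "capped u \<Longrightarrow> density u"
  unfolding density_def capped_def
  by (auto intro!: Bochner_Integration.integrable_bound[OF cap_integrable(1)[OF T0]] simp: cap_nonneg)

lemma cap_density: "density (cap T)"
  by (simp add: density_def cap_integrable(1)[OF T0] cap_nonneg)

lemma incline_set_integrable:
  assumes w: "incline w"
  shows "set_integrable lebesgue {a..b} w"
  unfolding set_integrable_def
proof (rule Bochner_Integration.integrable_bound)
  show "integrable lebesgue (indicator {a..b} :: real \<Rightarrow> real)"
    using lmeasurable_interval(1)[of a b] by (intro integrable_real_indicator) (auto simp: fmeasurable_def)
  show "(\<lambda>x. indicator {a..b} x *\<^sub>R w x) \<in> borel_measurable lebesgue"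
    using inclineD(1)[OF w] by (intro borel_measurable_scaleR borel_measurable_indicator) auto
  show "AE x in lebesgue. norm (indicator {a..b} x *\<^sub>R w x) \<le> norm (indicator {a..b} x :: real)"
    using inclineD(3,4)[OF w] by (intro AE_I2) (auto simp: indicator_def)
qed

text \<open>The upper bound makes all heights equicontinuous; the lower one, with
  \<open>sin \<theta>0 > 0\<close>, keeps limits of heights strictly increasing.\<close>

lemma height_diff:
  assumes w: "incline w" and st: "0 \<le> s" "s \<le> t"
  shows "sin \<theta>0 * (t - s) \<le> height w t - height w s" "height w t - height w s \<le> t - s"
proof -
  have i2: "set_integrable lebesgue {s<..t} w"
    by (rule set_integrable_subset[OF incline_set_integrable[OF w, of s t]]) auto
  have ci: "set_integrable lebesgue {s<..t} (\<lambda>_. k)" for k :: real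
    by (rule set_integrable_subset[of _ "{s..t}"])
      (use lmeasurable_interval(1)[of s t] in \<open>auto simp: set_integrable_def fmeasurable_def
        intro!: integrable_scaleR_left integrable_real_indicator\<close>)
  have eq: "{0..t} = {0..s} \<union> {s<..t}" using st by auto
  have "height w t = height w s + (LINT x:{s<..t}|lebesgue. w x)"
    unfolding height_def eq by (rule set_integral_Un[OF _ incline_set_integrable[OF w] i2]) auto
  moreover have "(LINT x:{s<..t}|lebesgue. w x) \<le> (LINT x:{s<..t}|lebesgue. 1)"
    by (intro set_integral_mono i2 ci inclineD[OF w])
  moreover have "(LINT x:{s<..t}|lebesgue. sin \<theta>0) \<le> (LINT x:{s<..t}|lebesgue. w x)"
    by (intro set_integral_mono i2 ci inclineD[OF w])
  moreover have "(LINT x:{s<..t}|lebesgue. k) = k * (t - s)" for k :: real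
    using st by (simp add: set_lebesgue_integral_def measure_completion)
  ultimately show "sin \<theta>0 * (t - s) \<le> height w t - height w s" "height w t - height w s \<le> t - s"
    by auto
qed

lemma height_0: "height w 0 = 0"
proof -
  have "AE x in lebesgue. indicator {0..0} x *\<^sub>R w x = 0"
    by (rule AE_I[where N = "{0}"]) (auto simp: indicator_def)
  then show ?thesis
    unfolding height_def set_lebesgue_integral_def by (rule integral_eq_zero_AE)
qed

lemma height_mono:
  assumes w: "incline w" and st: "0 \<le> s" "s \<le> t"
  shows "height w s \<le> height w t"
proof -
  have "0 \<le> sin \<theta>0 * (t - s)" using st sin_pos by simp
  then show ?thesis using height_diff[OF assms] by linarith
qed

lemma height_nonneg: "incline w \<Longrightarrow> 0 \<le> t \<Longrightarrow> 0 \<le> height w t"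
  using height_mono[of w 0 t] by (simp add: height_0)

lemma zstate_nonneg: "density u \<Longrightarrow> 0 \<le> zstate2 u t"
  unfolding density_def zstate2_def set_lebesgue_integral_def
  by (intro Bochner_Integration.integral_nonneg) auto

lemma density_tail_integrable:
  assumes "density u" "A \<in> sets lebesgue"
  shows "set_integrable lebesgue A u"
  unfolding set_integrable_def using assms by (intro integrable_mult_indicator) (auto simp: density_def)

lemma zstate_diff:
  assumes "density u" "s \<le> t"
  shows "zstate2 u s - zstate2 u t = (LINT x:{s..<t}|lebesgue. u x)"
proof -
  have eq: "{s..} = {s..<t} \<union> {t..}" using assms by auto
  have "zstate2 u s = (LINT x:{s..<t}|lebesgue. u x) + zstate2 u t"
    unfolding zstate2_def eq by (intro set_integral_Un density_tail_integrable[OF assms(1)]) auto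
  then show ?thesis by simp
qed

lemma zstate_antimono:
  assumes "density u" "s \<le> t"
  shows "zstate2 u t \<le> zstate2 u s"
proof -
  have "0 \<le> (LINT x:{s..<t}|lebesgue. u x)"
    unfolding set_lebesgue_integral_def
    using assms by (intro Bochner_Integration.integral_nonneg) (auto simp: density_def)
  then show ?thesis using zstate_diff[OF assms] by simp
qed

text \<open>The tail of the cap provides one modulus of continuity for all capped densities.\<close>

lemma zstate_diff_le_cap:
  assumes "capped u" "s \<le> t"
  shows "zstate2 u s - zstate2 u t \<le> zstate2 (cap T) s - zstate2 (cap T) t"
  using assms unfolding zstate_diff[OF capped_density[OF assms(1)] assms(2)] zstate_diff[OF cap_density assms(2)]
  by (intro set_integral_mono density_tail_integrable capped_density cap_density) (auto simp: capped_def)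

lemma zstate_cap_le: "zstate2 (cap T) t \<le> 6 * T"
proof -
  have "zstate2 (cap T) t \<le> (\<integral>t. cap T t \<partial>lebesgue)"
    unfolding zstate2_def set_lebesgue_integral_def
    using cap_integrable(1)[OF T0] by (intro integral_mono integrable_mult_indicator) (auto simp: indicator_def cap_nonneg)
  also have "\<dots> \<le> 6 * T" using T0 by (simp add: cap_integrable(2)[OF T0])
  finally show ?thesis .
qed

lemma zstate_capped_le:
  assumes "capped u"
  shows "zstate2 u t \<le> 6 * T"
proof -
  have "zstate2 u t \<le> zstate2 (cap T) t"
    unfolding zstate2_def
    using assms by (intro set_integral_mono density_tail_integrable capped_density cap_density) (auto simp: capped_def)
  then show ?thesis using zstate_cap_le[of t] by linarith
qed

lemma capped_outside: "capped u \<Longrightarrow> t \<notin> {0..T} \<Longrightarrow> u t = 0"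
  unfolding capped_def using cap_outside[of t T] by (metis atLeastAtMost_iff not_le order_antisym)

lemma zstate_zero:
  assumes "capped u" "T < t"
  shows "zstate2 u t = 0"
proof -
  have "zstate2 u t = (LINT x:{t..}|lebesgue. (0::real))"
    unfolding zstate2_def using assms capped_outside[OF assms(1)] by (intro set_lebesgue_integral_cong) auto
  then show ?thesis by simp
qed

text \<open>A composition of monotone functions is monotone, so measurability holds although
  \<open>I\<close> may jump.\<close>

lemma intensity_measurable:
  assumes w: "incline w" and "A \<subseteq> {0..}" "A \<in> sets borel"
  shows "(\<lambda>t. I (height w t)) \<in> borel_measurable (lebesgue_on A)"
  using assms(2,3) height_mono[OF w] height_nonneg[OF w]
  by (intro mono_on_measurable_lebesgue_on mono_onI mono_onD[OF Imono]) auto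

lemma zstate_measurable:
  assumes u: "density u"
  shows "zstate2 u \<in> borel_measurable lebesgue"
proof -
  have "mono (\<lambda>t. - zstate2 u t)" using zstate_antimono[OF u] by (auto simp: mono_def)
  then have "(\<lambda>t. - zstate2 u t) \<in> borel_measurable borel" by (rule borel_measurable_mono)
  then have "zstate2 u \<in> borel_measurable borel" by (rule borel_measurable_uminus_eq[THEN iffD1])
  then show ?thesis by (simp add: measurable_completion)
qed

lemma gain_bounds:
  assumes "incline w" "density u"
  shows "0 \<le> gain w u t" "gain w u t \<le> 1" "gain w u t \<le> u t"
proof -
  note s = inclineD(5,6)[OF assms(1), of t]
  have u: "0 \<le> u t" using assms by (simp add: density_def)
  show "0 \<le> gain w u t" "gain w u t \<le> 1" "gain w u t \<le> u t"
    unfolding gain_def using light_nonneg[OF s(1) u] light_le_left[OF s(1), of "u t"] light_le_right[OF s(1), of "u t"] s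
    by auto
qed

lemma reward_bounds:
  assumes "incline w" "density u" "0 \<le> t"
  shows "0 \<le> I (height w t) * gain w u t" "I (height w t) * gain w u t \<le> gain w u t"
  using I01 gain_bounds[OF assms(1,2), of t] height_nonneg[OF assms(1,3)]
  by (auto intro: mult_left_le_one_le)

lemma restrict_lebesgue: "f \<in> borel_measurable lebesgue \<Longrightarrow> f \<in> borel_measurable (lebesgue_on A)"
  by (rule measurable_restrict_space1)

lemma gain_measurable_on:
  assumes "incline w" "density u"
  shows "gain w u \<in> borel_measurable lebesgue"
  unfolding gain_def[abs_def] using inclineD(1)[OF assms(1)] assms(2)
  by (intro gain_measurable) (auto simp: density_def)

lemma reward_measurable:
  assumes "incline w" "density u"
  shows "(\<lambda>t. I (height w t) * gain w u t) \<in> borel_measurable (lebesgue_on {0..})"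
  using intensity_measurable[OF assms(1), of "{0..}"] restrict_lebesgue[OF gain_measurable_on[OF assms]]
  by (intro borel_measurable_times) auto

text \<open>The reward is dominated by the integrable density \<open>u\<close>. Hence only the cost
  can make the functional infinite.\<close>

lemma reward_integrable:
  assumes "incline w" "density u"
  shows "integrable (lebesgue_on {0..}) (\<lambda>t. I (height w t) * gain w u t)"
proof (rule Bochner_Integration.integrable_bound)
  show "integrable (lebesgue_on {0..}) u"
    using density_tail_integrable[OF assms(2), of "{0..}"]
    by (subst integrable_restrict_space) (auto simp: set_integrable_def)
  show "(\<lambda>t. I (height w t) * gain w u t) \<in> borel_measurable (lebesgue_on {0..})"
    using reward_measurable[OF assms] .
  show "AE t in lebesgue_on {0..}. norm (I (height w t) * gain w u t) \<le> norm (u t)"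
  proof (intro AE_I2)
    fix t :: real assume "t \<in> space (lebesgue_on {0..})"
    then have "0 \<le> t" by simp
    then show "norm (I (height w t) * gain w u t) \<le> norm (u t)"
      using reward_bounds[OF assms \<open>0 \<le> t\<close>] gain_bounds[OF assms, of t] by auto
  qed
qed

lemma cost_nonneg: "0 \<le> cost u t"
  using c0 by (simp add: cost_def)

lemma cost_measurable:
  assumes "density u"
  shows "cost u \<in> borel_measurable lebesgue"
  using zstate_measurable[OF assms] unfolding cost_def[abs_def] by measurable

lemma cost_capped_le: "capped u \<Longrightarrow> cost u t \<le> c * (6 * T) powr \<alpha>"
  unfolding cost_def using c0 al zstate_capped_le zstate_nonneg[OF capped_density]
  by (intro mult_left_mono powr_mono2) auto

lemma finite_measure_interval: "finite_measure (lebesgue_on {0..T})"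
  using T0 by (intro finite_measureI) (simp add: emeasure_restrict_space)

lemma cost_integrable_interval:
  assumes "capped u"
  shows "integrable (lebesgue_on {0..T}) (cost u)"
proof -
  interpret finite_measure "lebesgue_on {0..T}" by (rule finite_measure_interval)
  show ?thesis
    using cost_capped_le[OF assms] cost_nonneg restrict_lebesgue[OF cost_measurable[OF capped_density[OF assms]]]
    by (intro integrable_const_bound[where B = "c * (6 * T) powr \<alpha>"]) auto
qed

lemma restrict_interval:
  fixes f :: "real \<Rightarrow> real"
  assumes "\<And>t. T < t \<Longrightarrow> f t = 0"
  shows "integrable (lebesgue_on {0..}) f \<longleftrightarrow> integrable (lebesgue_on {0..T}) f"
    "integral\<^sup>L (lebesgue_on {0..}) f = integral\<^sup>L (lebesgue_on {0..T}) f"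
proof -
  have "(\<lambda>x. indicator {0..} x *\<^sub>R f x) = (\<lambda>x. indicator {0..T} x *\<^sub>R f x)"
    using assms by (auto simp: fun_eq_iff indicator_def)
  then show "integrable (lebesgue_on {0..}) f \<longleftrightarrow> integrable (lebesgue_on {0..T}) f"
    "integral\<^sup>L (lebesgue_on {0..}) f = integral\<^sup>L (lebesgue_on {0..T}) f"
    by (auto simp: integrable_restrict_space integral_restrict_space)
qed

lemma reduced_value_eq:
  assumes "capped u"
  shows "reduced_value w u = (\<integral>t. I (height w t) * gain w u t \<partial>lebesgue_on {0..}) - (\<integral>t. cost u t \<partial>lebesgue_on {0..})"
    "integrable (lebesgue_on {0..}) (cost u)"
proof -
  have g: "I (height w t) * gain w u t = 0" if "T < t" for t
    using capped_outside[OF assms] that by (simp add: gain_def light_def)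
  have k: "cost u t = 0" if "T < t" for t
    using zstate_zero[OF assms that] by (simp add: cost_def)
  show "integrable (lebesgue_on {0..}) (cost u)"
    using restrict_interval(1)[of "cost u", OF k] cost_integrable_interval[OF assms] by blast
  show "reduced_value w u = (\<integral>t. I (height w t) * gain w u t \<partial>lebesgue_on {0..}) - (\<integral>t. cost u t \<partial>lebesgue_on {0..})"
    using restrict_interval(2)[of "\<lambda>t. I (height w t) * gain w u t", OF g] restrict_interval(2)[of "cost u", OF k]
    by (simp add: reduced_value_def)
qed

section \<open>The original functional in terms of gain and cost\<close>

lemma payoff_eq:
  assumes "\<And>t. 0 \<le> t \<Longrightarrow> \<theta>0 \<le> \<theta> t \<and> \<theta> t \<le> pi / 2"
    and "\<And>t. 0 \<le> t \<Longrightarrow> w t = sin (\<theta> t)" and "\<And>t. 0 \<le> t \<Longrightarrow> v t = u t" and "0 \<le> t"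
  shows "payoff2 \<theta>0 \<alpha> c I \<theta> u t = I (height w t) * gain w v t - cost v t"
proof -
  have "height2 \<theta> t = height w t"
    unfolding height2_def height_def using assms by (intro set_lebesgue_integral_cong) auto
  moreover have "zstate2 u t = zstate2 v t"
    unfolding zstate2_def using assms by (intro set_lebesgue_integral_cong) auto
  moreover have "G2 \<theta>0 (\<theta> t) (u t) = gain w v t"
    using slope_sin[of \<theta>0 "\<theta> t"] assms th0 by (simp add: G2_def gain_def light_def mult.commute)
  ultimately show ?thesis by (simp add: payoff2_def cost_def)
qed

lemma J2_eq_integral:
  assumes "\<And>t. 0 \<le> t \<Longrightarrow> payoff2 \<theta>0 \<alpha> c I \<theta> u t = A t - B t"
    and "integrable (lebesgue_on {0..}) A" "integrable (lebesgue_on {0..}) B"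
  shows "J2 \<theta>0 \<alpha> c I \<theta> u = ereal (integral\<^sup>L (lebesgue_on {0..}) A - integral\<^sup>L (lebesgue_on {0..}) B)"
proof -
  have "J2 \<theta>0 \<alpha> c I \<theta> u =
     enn2ereal (\<integral>\<^sup>+ t. ennreal (max 0 (A t - B t)) \<partial>(lebesgue_on {0..}))
     - enn2ereal (\<integral>\<^sup>+ t. ennreal (max 0 (- (A t - B t))) \<partial>(lebesgue_on {0..}))"
    unfolding J2_eq_restrict using assms(1)
    by (intro arg_cong2[where f = minus] arg_cong[where f = enn2ereal] nn_integral_cong) auto
  also have "\<dots> = ereal (\<integral>t. A t - B t \<partial>lebesgue_on {0..})"
    using assms by (intro enn2ereal_pos_part_minus_neg_part) auto
  finally show ?thesis using assms by simp
qed

text \<open>The pointwise bound \<open>B \<le> A + max 0 (B - A)\<close>, with \<open>A\<close>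
  integrable, forces the negative part to have infinite integral, while the positive part stays
  below \<open>A\<close>.\<close>

lemma J2_eq_minus_infinity:
  assumes eq: "\<And>t. 0 \<le> t \<Longrightarrow> payoff2 \<theta>0 \<alpha> c I \<theta> u t = A t - B t"
    and A: "integrable (lebesgue_on {0..}) A" and A0: "\<And>t. 0 \<le> t \<Longrightarrow> 0 \<le> A t"
    and [measurable]: "B \<in> borel_measurable (lebesgue_on {0..})" and B0: "\<And>t. 0 \<le> t \<Longrightarrow> 0 \<le> B t"
    and inf: "(\<integral>\<^sup>+ t. ennreal (B t) \<partial>(lebesgue_on {0..})) = \<infinity>"
  shows "J2 \<theta>0 \<alpha> c I \<theta> u = - \<infinity>"
proof -
  let ?L = "lebesgue_on {0..} :: real measure"
  have [measurable]: "A \<in> borel_measurable ?L" using A by simp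
  have fin: "(\<integral>\<^sup>+ t. ennreal (A t) \<partial>?L) < \<infinity>"
    using A unfolding real_integrable_def by (simp add: top.not_eq_extremum)
  have J: "J2 \<theta>0 \<alpha> c I \<theta> u =
     enn2ereal (\<integral>\<^sup>+ t. ennreal (max 0 (A t - B t)) \<partial>?L)
     - enn2ereal (\<integral>\<^sup>+ t. ennreal (max 0 (- (A t - B t))) \<partial>?L)"
    unfolding J2_eq_restrict using eq
    by (intro arg_cong2[where f = minus] arg_cong[where f = enn2ereal] nn_integral_cong) auto
  have "(\<integral>\<^sup>+ t. ennreal (max 0 (A t - B t)) \<partial>?L) \<le> (\<integral>\<^sup>+ t. ennreal (A t) \<partial>?L)"
    using A0 B0 by (intro nn_integral_mono ennreal_leI) auto
  then have p: "(\<integral>\<^sup>+ t. ennreal (max 0 (A t - B t)) \<partial>?L) < \<infinity>" using fin by (rule le_less_trans)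
  have "\<infinity> \<le> (\<integral>\<^sup>+ t. ennreal (A t) + ennreal (max 0 (- (A t - B t))) \<partial>?L)"
    unfolding inf[symmetric] using A0 B0
    by (intro nn_integral_mono) (auto simp: ennreal_plus[symmetric] simp del: ennreal_plus intro!: ennreal_leI)
  also have "\<dots> = (\<integral>\<^sup>+ t. ennreal (A t) \<partial>?L) + (\<integral>\<^sup>+ t. ennreal (max 0 (- (A t - B t))) \<partial>?L)"
    by (intro nn_integral_add) auto
  finally have n: "(\<integral>\<^sup>+ t. ennreal (max 0 (- (A t - B t))) \<partial>?L) = \<infinity>"
    using fin by (auto simp: top_unique)
  show ?thesis unfolding J n using p
    by (cases "\<integral>\<^sup>+ t. ennreal (max 0 (A t - B t)) \<partial>?L") auto
qed

lemma reduced_control_admissible: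
  assumes w: "incline w" and u: "capped u"
  shows "admissible2 \<theta>0 (\<lambda>t. arcsin (w t)) u"
    "J2 \<theta>0 \<alpha> c I (\<lambda>t. arcsin (w t)) u = ereal (reduced_value w u)"
proof -
  note a = sin_arcsin_control[OF th0 inclineD(2,3)[OF w]]
  have bd: "-1 \<le> w t" "w t \<le> 1" for t using inclineD(3,4)[OF w, of t] by auto
  \<comment> \<open>\<open>arcsin\<close> is continuous on \<open>{-1..1}\<close>; its extension by
    zero is Borel on the whole line and agrees with it on the values of \<open>w\<close>.\<close>
  have "arcsin \<in> borel_measurable (restrict_space borel {-1..1})"
    by (intro borel_measurable_continuous_on_restrict continuous_on_arcsin') 
  then have "(\<lambda>x. if x \<in> {-1..1} then arcsin x else 0) \<in> borel_measurable borel"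
    by (subst (asm) measurable_restrict_space_iff[where c = 0]) auto
  then have "(\<lambda>t. if w t \<in> {-1..1} then arcsin (w t) else 0) \<in> borel_measurable lebesgue"
    by (rule measurable_compose[OF inclineD(1)[OF w]])
  then have m: "(\<lambda>t. arcsin (w t)) \<in> borel_measurable lebesgue" using bd by simp
  show "admissible2 \<theta>0 (\<lambda>t. arcsin (w t)) u"
    unfolding admissible2_def
  proof (intro conjI)
    show "(\<lambda>t. arcsin (w t)) \<in> borel_measurable (lebesgue_on {0..})" by (rule restrict_lebesgue[OF m])
    show "u \<in> borel_measurable (lebesgue_on {0..})" using u by (intro restrict_lebesgue) (simp add: capped_def)
    show "\<forall>t\<ge>0. \<theta>0 \<le> arcsin (w t) \<and> arcsin (w t) \<le> pi / 2" using a by blast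
    show "\<forall>t\<ge>0. 0 \<le> u t" using u by (simp add: capped_def)
    show "set_integrable lebesgue {0..} u" by (rule density_tail_integrable[OF capped_density[OF u]]) simp
  qed
  have "J2 \<theta>0 \<alpha> c I (\<lambda>t. arcsin (w t)) u
    = ereal (integral\<^sup>L (lebesgue_on {0..}) (\<lambda>t. I (height w t) * gain w u t) - integral\<^sup>L (lebesgue_on {0..}) (cost u))"
  proof (rule J2_eq_integral)
    show "payoff2 \<theta>0 \<alpha> c I (\<lambda>t. arcsin (w t)) u t = I (height w t) * gain w u t - cost u t" if "0 \<le> t" for t
      by (rule payoff_eq[OF _ _ _ that]) (use a in blast, simp_all add: a(3))
  qed (rule reward_integrable[OF w capped_density[OF u]], rule reduced_value_eq(2)[OF u])
  then show "J2 \<theta>0 \<alpha> c I (\<lambda>t. arcsin (w t)) u = ereal (reduced_value w u)"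
    using reduced_value_eq(1)[OF u, of w] by simp
qed

section \<open>Truncation at the cap does not lower the value\<close>

lemma gain_truncate_le:
  assumes w: "incline w" and v: "density v" and t: "0 < t"
  defines "u \<equiv> \<lambda>t. min (v t) (cap T t)"
  shows "I (height w t) * gain w v t \<le> I (height w t) * gain w u t + min 1 (t / T) * min 1 (v t - u t)"
proof -
  have I: "0 \<le> I (height w t)" "I (height w t) \<le> 1"
    using I01 height_nonneg[OF w, of t] t by auto
  have v0: "0 \<le> v t" using v by (simp add: density_def)
  have u0: "0 \<le> u t" "u t \<le> v t" using v0 by (auto simp: u_def cap_nonneg)
  have nn: "0 \<le> min 1 (t / T) * min 1 (v t - u t)" using u0 t T0 by simp
  have "gain w v t - gain w u t \<le> exp (- u t) * min 1 (v t - u t)"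
    using light_increment[of "slope \<theta>0 (w t)" "u t" "v t - u t"] inclineD(5,6)[OF w] u0 by (simp add: gain_def)
  also have "\<dots> \<le> min 1 (t / T) * min 1 (v t - u t)"
  \<comment> \<open>Below the cap nothing is removed and both sides vanish. Above it
    \<open>u t\<close> is the cap itself, whose exponential is at most
    \<open>min 1 (t / T)\<close>.\<close>
  proof (cases "v t \<le> cap T t")
    case True
    then show ?thesis by (simp add: u_def)
  next
    case False
    then have "u t = cap T t" by (simp add: u_def)
    then show ?thesis using exp_minus_cap_le[OF T0 t] u0 by (intro mult_right_mono) auto
  qed
  finally have "I (height w t) * (gain w v t - gain w u t) \<le> I (height w t) * (min 1 (t / T) * min 1 (v t - u t))"
    using I by (intro mult_left_mono)
  also have "\<dots> \<le> min 1 (t / T) * min 1 (v t - u t)"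
    using I nn by (intro mult_left_le_one_le)
  finally show ?thesis by (simp add: algebra_simps)
qed

text \<open>The removed tail is cut at \<open>T\<close> so that, added to the at most
  \<open>6 * T\<close> that remain, it stays within \<open>7 * T\<close>, where the slope of the
  power function is bounded below.\<close>

lemma cost_truncate_ge:
  assumes u: "capped u" and g: "density g" and v: "zstate2 v t = zstate2 u t + zstate2 g t"
  shows "cost u t + c * (\<alpha> * (7 * T) powr (\<alpha> - 1)) * min (zstate2 g t) T \<le> cost v t"
proof -
  let ?d = "min (zstate2 g t) T"
  have nn: "0 \<le> zstate2 u t" "0 \<le> zstate2 g t" using zstate_nonneg capped_density[OF u] g by auto
  have "\<alpha> * (7 * T) powr (\<alpha> - 1) * ?d \<le> (zstate2 u t + ?d) powr \<alpha> - zstate2 u t powr \<alpha>"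
    using zstate_capped_le[OF u, of t] nn al T0 by (intro powr_increment_ge) auto
  moreover have "(zstate2 u t + ?d) powr \<alpha> \<le> zstate2 v t powr \<alpha>"
    using nn al T0 v by (intro powr_mono2) auto
  ultimately have "c * (\<alpha> * (7 * T) powr (\<alpha> - 1) * ?d) \<le> c * (zstate2 v t powr \<alpha> - zstate2 u t powr \<alpha>)"
    using c0 by (intro mult_left_mono) auto
  then show ?thesis by (simp add: cost_def algebra_simps)
qed

text \<open>Lost gain is at most \<open>2 / T\<close> times the integral of
  \<open>min (zstate2 g t) T\<close> by \<open>truncation_loss_le\<close>; saved cost is at least
  \<open>K\<close> times the same integral, and \<open>T_large\<close> states
  \<open>2 / T \<le> K\<close>.\<close>

lemma truncation_improves:
  assumes w: "incline w" and v: "density v"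
    and fin: "integrable (lebesgue_on {0..}) (cost v)"
  defines "u \<equiv> \<lambda>t. min (v t) (cap T t)"
  shows "(\<integral>t. I (height w t) * gain w v t \<partial>lebesgue_on {0..}) - (\<integral>t. cost v t \<partial>lebesgue_on {0..})
    \<le> reduced_value w u"
proof -
  let ?L = "lebesgue_on {0..} :: real measure"
  define g where "g t = v t - u t" for t
  define K where "K = c * (\<alpha> * (7 * T) powr (\<alpha> - 1))"
  define E where "E t = K * min (zstate2 g t) T" for t
  have K0: "0 < K" using c0 al T0 by (simp add: K_def)
  have KT: "2 / T \<le> K" using T_large T0 by (simp add: K_def field_simps)
  have vi: "integrable lebesgue v" and v0: "\<And>t. 0 \<le> v t" using v by (auto simp: density_def)
  have u: "capped u"
    unfolding capped_def u_def using vi v0 cap_integrable(1)[OF T0] cap_nonneg by auto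
  have ud: "density u" by (rule capped_density[OF u])
  have ui: "integrable lebesgue u" using ud by (simp add: density_def)
  have g: "density g" unfolding density_def g_def using vi ui by (auto simp: u_def)
  have gi: "integrable lebesgue g" and g0: "\<And>t. 0 \<le> g t" using g by (auto simp: density_def)
  have z: "zstate2 v t = zstate2 u t + zstate2 g t" for t
  proof -
    have "zstate2 u t + zstate2 g t = (LINT s:{t..}|lebesgue. u s + g s)"
      unfolding zstate2_def using density_tail_integrable ud g by (intro set_integral_add(2)[symmetric]) auto
    then show ?thesis by (simp add: g_def zstate2_def)
  qed
  have E0: "0 \<le> E t" for t using K0 zstate_nonneg[OF g] T0 by (simp add: E_def)
  have costE: "cost u t + E t \<le> cost v t" for t
    using cost_truncate_ge[OF u g z] by (simp add: E_def K_def)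
  have Em: "E \<in> borel_measurable ?L"
    unfolding E_def[abs_def] using restrict_lebesgue[OF zstate_measurable[OF g]] by measurable
  have Ei: "integrable ?L E"
  proof (rule Bochner_Integration.integrable_bound[OF fin Em], intro AE_I2)
    fix t show "norm (E t) \<le> norm (cost v t)"
      using costE[of t] E0[of t] cost_nonneg[of u t] by simp
  qed
  note cu = reduced_value_eq(2)[OF u]
  have "(\<integral>t. cost u t + E t \<partial>?L) \<le> (\<integral>t. cost v t \<partial>?L)"
    using cu Ei fin costE by (intro integral_mono) auto
  then have c1: "(\<integral>t. cost u t \<partial>?L) + (\<integral>t. E t \<partial>?L) \<le> (\<integral>t. cost v t \<partial>?L)"
    using cu Ei by simp
  define A where "A x t = I (height w t) * gain w x t" for x t
  have Ai: "integrable ?L (A v)" "integrable ?L (A u)"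
    using reward_integrable[OF w v] reward_integrable[OF w ud] by (auto simp: A_def[abs_def])
  have A0: "0 \<le> A v t" "0 \<le> A u t" if "0 \<le> t" for t
    using reward_bounds(1)[OF w v that] reward_bounds(1)[OF w ud that] by (auto simp: A_def)
  have gm: "(\<lambda>t. ennreal (min 1 (t / T) * min 1 (g t))) \<in> borel_measurable ?L"
  proof -
    have [measurable]: "g \<in> borel_measurable ?L" "(\<lambda>t::real. t) \<in> borel_measurable ?L"
      using gi by (auto intro!: restrict_lebesgue simp: measurable_completion)
    show ?thesis by measurable
  qed
  \<comment> \<open>At \<open>t = 0\<close> the cap is zero and \<open>exp_minus_cap_le\<close>
    would fail there; this single point is discarded.\<close>
  have "AE t in ?L. t \<noteq> (0::real)"
    by (subst AE_restrict_space_iff) (auto intro!: AE_I[where N = "{0}"])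
  moreover have "AE t in ?L. 0 \<le> t" by (intro AE_I2) simp
  ultimately have "AE t in ?L. ennreal (A v t) \<le> ennreal (A u t) + ennreal (min 1 (t / T) * min 1 (g t))"
  proof eventually_elim
    case (elim t)
    then have "A v t \<le> A u t + min 1 (t / T) * min 1 (g t)"
      using gain_truncate_le[OF w v, of t] by (simp add: A_def g_def u_def)
    moreover have "0 \<le> min 1 (t / T) * min 1 (g t)" using elim T0 g0[of t] by simp
    moreover have "0 \<le> A u t" using A0 elim by simp
    ultimately show ?case by (metis ennreal_leI ennreal_plus)
  qed
  then have "(\<integral>\<^sup>+t. ennreal (A v t) \<partial>?L)
      \<le> (\<integral>\<^sup>+t. ennreal (A u t) + ennreal (min 1 (t / T) * min 1 (g t)) \<partial>?L)"
    by (rule nn_integral_mono_AE)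
  also have "\<dots> = (\<integral>\<^sup>+t. ennreal (A u t) \<partial>?L) + (\<integral>\<^sup>+t. ennreal (min 1 (t / T) * min 1 (g t)) \<partial>?L)"
    using Ai gm by (intro nn_integral_add) auto
  also have "(\<integral>\<^sup>+t. ennreal (min 1 (t / T) * min 1 (g t)) \<partial>?L)
      \<le> ennreal (2 / T) * (\<integral>\<^sup>+t. ennreal (min (zstate2 g t) T) \<partial>?L)"
    using truncation_loss_le[OF gi g0 T0]
    by (simp add: nn_integral_restrict_space zstate2_def)
  also have "\<dots> \<le> ennreal K * (\<integral>\<^sup>+t. ennreal (min (zstate2 g t) T) \<partial>?L)"
    using KT by (intro mult_right_mono ennreal_leI) auto
  also have "\<dots> = (\<integral>\<^sup>+t. ennreal (E t) \<partial>?L)"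
  proof -
    have "(\<lambda>t. ennreal (min (zstate2 g t) T)) \<in> borel_measurable ?L"
      using restrict_lebesgue[OF zstate_measurable[OF g]] by measurable
    then show ?thesis
      unfolding E_def using K0 by (simp add: ennreal_mult' nn_integral_cmult)
  qed
  finally have le: "(\<integral>\<^sup>+t. ennreal (A v t) \<partial>?L) \<le> (\<integral>\<^sup>+t. ennreal (A u t) \<partial>?L) + (\<integral>\<^sup>+t. ennreal (E t) \<partial>?L)"
    by (simp add: add_left_mono)
  have eqs: "(\<integral>\<^sup>+t. ennreal (A v t) \<partial>?L) = ennreal (integral\<^sup>L ?L (A v))"
     "(\<integral>\<^sup>+t. ennreal (A u t) \<partial>?L) = ennreal (integral\<^sup>L ?L (A u))"
     "(\<integral>\<^sup>+t. ennreal (E t) \<partial>?L) = ennreal (integral\<^sup>L ?L E)"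
    by (rule nn_integral_eq_integral; use Ai Ei A0 E0 in \<open>auto intro!: AE_I2\<close>)+
  have n: "0 \<le> integral\<^sup>L ?L (A u)" "0 \<le> integral\<^sup>L ?L E"
    by (rule integral_nonneg_AE; use A0 E0 in \<open>auto intro!: AE_I2\<close>)+
  have "integral\<^sup>L ?L (A v) \<le> integral\<^sup>L ?L (A u) + integral\<^sup>L ?L E"
    using le n unfolding eqs by (simp add: ennreal_plus[symmetric] ennreal_le_iff del: ennreal_plus)
  then show ?thesis
    using c1 reduced_value_eq(1)[OF u, of w] by (simp add: A_def[abs_def])
qed

text \<open>If the cost has infinite integral, the value is minus infinity and every capped control
  is at least as good; otherwise truncation applies.\<close>

lemma reduce_admissible:
  assumes "admissible2 \<theta>0 \<theta> v"
  obtains w u where "incline w" "capped u" "J2 \<theta>0 \<alpha> c I \<theta> v \<le> ereal (reduced_value w u)"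
proof -
  have th: "\<theta> \<in> borel_measurable (lebesgue_on {0..})" "\<And>t. 0 \<le> t \<Longrightarrow> \<theta>0 \<le> \<theta> t \<and> \<theta> t \<le> pi / 2"
    and v: "\<And>t. 0 \<le> t \<Longrightarrow> 0 \<le> v t" "set_integrable lebesgue {0..} v"
    using assms by (auto simp: admissible2_def)
  \<comment> \<open>Controls prescribed on \<open>{0..}\<close> are continued to negative times by
    the admissible constants \<open>1\<close> for \<open>w\<close> and \<open>0\<close> for the
    density.\<close>
  define w where "w t = (if t \<in> {0..} then sin (\<theta> t) else 1)" for t
  define v' where "v' t = indicator {0..} t *\<^sub>R v t" for t
  have w: "incline w"
    unfolding incline_def
  proof (intro conjI allI)
    have "(\<lambda>t. sin (\<theta> t)) \<in> borel_measurable (lebesgue_on {0..})" using th(1) by measurable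
    then show "w \<in> borel_measurable lebesgue"
      unfolding w_def[abs_def] by (subst (asm) measurable_restrict_space_iff[where c = 1]) auto
    show "sin \<theta>0 \<le> w t" for t
      using th(2)[of t] th0 by (auto simp: w_def intro!: sin_monotone_2pi_le)
    show "w t \<le> 1" for t by (simp add: w_def)
  qed
  have v': "density v'"
    using v by (auto simp: density_def v'_def[abs_def] set_integrable_def indicator_def)
  have pay: "payoff2 \<theta>0 \<alpha> c I \<theta> v t = I (height w t) * gain w v' t - cost v' t" if "0 \<le> t" for t
    using th that by (intro payoff_eq) (auto simp: w_def v'_def)
  define u where "u t = min (v' t) (cap T t)" for t
  have u: "capped u"
    unfolding capped_def u_def using v' cap_integrable(1)[OF T0] cap_nonneg by (auto simp: density_def)
  have cm: "cost v' \<in> borel_measurable (lebesgue_on {0..})"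
    by (rule restrict_lebesgue[OF cost_measurable[OF v']])
  have "J2 \<theta>0 \<alpha> c I \<theta> v \<le> ereal (reduced_value w u)"
  proof (cases "(\<integral>\<^sup>+ t. ennreal (cost v' t) \<partial>(lebesgue_on {0..})) = \<infinity>")
    case True
    have "J2 \<theta>0 \<alpha> c I \<theta> v = - \<infinity>"
      using pay reward_integrable[OF w v'] reward_bounds(1)[OF w v'] cm cost_nonneg True
      by (rule J2_eq_minus_infinity)
    then show ?thesis by simp
  next
    case False
    then have ci: "integrable (lebesgue_on {0..}) (cost v')"
      using cm cost_nonneg by (intro integrableI_bounded) (auto simp: less_top)
    then have "J2 \<theta>0 \<alpha> c I \<theta> v = ereal ((\<integral>t. I (height w t) * gain w v' t \<partial>lebesgue_on {0..}) - (\<integral>t. cost v' t \<partial>lebesgue_on {0..}))"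
      using pay reward_integrable[OF w v'] by (intro J2_eq_integral)
    then show ?thesis using truncation_improves[OF w v' ci] by (simp add: u_def[abs_def])
  qed
  then show thesis using that w u by blast
qed

subsection \<open>Existence for capped controls\<close>

lemma zstate_isCont:
  assumes "density v"
  shows "isCont (zstate2 v) t"
  unfolding zstate2_def[abs_def]
  using assms by (intro continuous_at_sequentiallyI tail_integral_tendsto) (auto simp: density_def)

section \<open>Continuity of states and gain under almost everywhere convergence\<close>

lemma height_tendsto:
  assumes "\<And>n. incline (wn n)" "incline w"
    and lim: "AE t in lebesgue_on {0..T}. (\<lambda>n. wn n t) \<longlonglongrightarrow> w t" and t: "t \<in> {0..T}"
  shows "(\<lambda>n. height (wn n) t) \<longlonglongrightarrow> height w t"
  unfolding height_def set_lebesgue_integral_def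
proof (rule integral_dominated_convergence[where w = "indicator {0..T}"])
  have m: "(\<lambda>s. indicator {0..t} s *\<^sub>R x s) \<in> borel_measurable lebesgue" if "incline x" for x
    using inclineD(1)[OF that] by (intro borel_measurable_scaleR borel_measurable_indicator) auto
  show "(\<lambda>s. indicator {0..t} s *\<^sub>R w s) \<in> borel_measurable lebesgue"
    "(\<lambda>s. indicator {0..t} s *\<^sub>R wn n s) \<in> borel_measurable lebesgue" for n
    using m assms by auto
  show "integrable lebesgue (indicator {0..T} :: real \<Rightarrow> real)"
    using lmeasurable_interval(1)[of 0 T] by (intro integrable_real_indicator) (auto simp: fmeasurable_def)
  show "AE s in lebesgue. (\<lambda>n. indicator {0..t} s *\<^sub>R wn n s) \<longlonglongrightarrow> indicator {0..t} s *\<^sub>R w s"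
    using lim t by (subst (asm) AE_restrict_space_iff) (auto elim!: eventually_mono simp: indicator_def)
  show "AE s in lebesgue. norm (indicator {0..t} s *\<^sub>R wn n s) \<le> indicator {0..T} s" for n
    using inclineD(3,4)[OF assms(1)[of n]] t by (intro AE_I2) (auto simp: indicator_def)
qed

lemma zstate_tendsto:
  assumes "\<And>n. capped (un n)" "capped u"
    and lim: "AE t in lebesgue_on {0..T}. (\<lambda>n. un n t) \<longlonglongrightarrow> u t"
  shows "(\<lambda>n. zstate2 (un n) t) \<longlonglongrightarrow> zstate2 u t"
  unfolding zstate2_def set_lebesgue_integral_def
proof (rule integral_dominated_convergence[where w = "cap T"])
  have m: "(\<lambda>s. indicator {t..} s *\<^sub>R x s) \<in> borel_measurable lebesgue" if "capped x" for x
    using that by (intro borel_measurable_scaleR borel_measurable_indicator) (auto simp: capped_def)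
  show "(\<lambda>s. indicator {t..} s *\<^sub>R u s) \<in> borel_measurable lebesgue"
    "(\<lambda>s. indicator {t..} s *\<^sub>R un n s) \<in> borel_measurable lebesgue" for n
    using m assms by auto
  show "integrable lebesgue (cap T)" by (rule cap_integrable(1)[OF T0])
  have "AE s in lebesgue. s \<in> {0..T} \<longrightarrow> (\<lambda>n. un n s) \<longlonglongrightarrow> u s"
    using lim by (subst (asm) AE_restrict_space_iff) auto
  then show "AE s in lebesgue. (\<lambda>n. indicator {t..} s *\<^sub>R un n s) \<longlonglongrightarrow> indicator {t..} s *\<^sub>R u s"
  proof eventually_elim
    case (elim s)
    then show ?case
      using capped_outside[OF assms(1)] capped_outside[OF assms(2)]
      by (cases "s \<in> {0..T}") (auto intro: tendsto_mult_left)
  qed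
  show "AE s in lebesgue. norm (indicator {t..} s *\<^sub>R un n s) \<le> cap T s" for n
    using assms(1)[of n] by (intro AE_I2) (auto simp: indicator_def capped_def cap_nonneg)
qed

lemma weighted_gain_tendsto:
  assumes wn: "\<And>n. incline (wn n)" "incline w" and un: "\<And>n. capped (un n)" "capped u"
    and limw: "AE t in lebesgue_on {0..T}. (\<lambda>n. wn n t) \<longlonglongrightarrow> w t"
    and limu: "AE t in lebesgue_on {0..T}. (\<lambda>n. un n t) \<longlonglongrightarrow> u t"
    and R: "R \<in> borel_measurable (lebesgue_on {0..T})" "\<forall>t\<in>{0..T}. 0 \<le> R t \<and> R t \<le> 1"
  shows "(\<lambda>n. \<integral>t. R t * gain (wn n) (un n) t \<partial>lebesgue_on {0..T}) \<longlonglongrightarrow> (\<integral>t. R t * gain w u t \<partial>lebesgue_on {0..T})"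
proof -
  interpret finite_measure "lebesgue_on {0..T}" by (rule finite_measure_interval)
  show ?thesis
  proof (rule integral_dominated_convergence[where w = "\<lambda>_. 1"])
    have m: "(\<lambda>t. R t * gain a b t) \<in> borel_measurable (lebesgue_on {0..T})" if "incline a" "capped b" for a b
      using R(1) restrict_lebesgue[OF gain_measurable_on[OF that(1) capped_density[OF that(2)]]]
      by (intro borel_measurable_times)
    show "(\<lambda>t. R t * gain w u t) \<in> borel_measurable (lebesgue_on {0..T})"
      "(\<lambda>t. R t * gain (wn n) (un n) t) \<in> borel_measurable (lebesgue_on {0..T})" for n
      using m wn un by auto
    show "AE t in lebesgue_on {0..T}. (\<lambda>n. R t * gain (wn n) (un n) t) \<longlonglongrightarrow> R t * gain w u t"
      using limw limu
    proof eventually_elim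
      case (elim t)
      then show ?case
        unfolding gain_def using inclineD(5)[OF wn(2), of t]
        by (intro tendsto_mult_left gain_tendsto) auto
    qed
    show "AE t in lebesgue_on {0..T}. norm (R t * gain (wn n) (un n) t) \<le> 1" for n
    proof (intro AE_I2)
      fix t assume "t \<in> space (lebesgue_on {0..T})"
      then have "t \<in> {0..T}" by simp
      then show "norm (R t * gain (wn n) (un n) t) \<le> 1"
        using R(2)[rule_format, of t] gain_bounds[OF wn(1)[of n] capped_density[OF un(1)[of n]], of t]
        by (simp add: abs_mult mult_le_one)
    qed
  qed simp
qed

text \<open>Heights are 1-Lipschitz and tails move no faster than the tail of the cap; each
  contributes at most half of \<open>e\<close>.\<close>

lemma equicontinuous_states:
  assumes "\<And>n. incline (w n)" "\<And>n. capped (u n)" "0 < e" "x \<in> {0..T}"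
  shows "\<exists>d>0. \<forall>n y. y \<in> {0..T} \<and> norm (x - y) < d \<longrightarrow>
     norm ((height (w n) x, zstate2 (u n) x) - (height (w n) y, zstate2 (u n) y)) < e"
proof -
  have "isCont (zstate2 (cap T)) x" by (rule zstate_isCont[OF cap_density])
  then obtain d where d: "0 < d" "\<And>y. dist y x < d \<Longrightarrow> dist (zstate2 (cap T) y) (zstate2 (cap T) x) < e / 2"
    using assms(3) unfolding continuous_at_eps_delta by (metis half_gt_zero dist_real_def)
  have "norm ((height (w n) x, zstate2 (u n) x) - (height (w n) y, zstate2 (u n) y)) < e"
    if y: "y \<in> {0..T}" "norm (x - y) < min d (e / 2)" for n y
  proof -
    have h: "\<bar>height (w n) a - height (w n) b\<bar> \<le> \<bar>a - b\<bar> \<and>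
        \<bar>zstate2 (u n) a - zstate2 (u n) b\<bar> \<le> \<bar>zstate2 (cap T) a - zstate2 (cap T) b\<bar>"
      if "0 \<le> a" "a \<le> b" for a b
      using height_diff(2)[OF assms(1) that, of n] height_mono[OF assms(1) that, of n]
        zstate_diff_le_cap[OF assms(2) that(2), of n]
        zstate_antimono[OF capped_density[OF assms(2)] that(2), of n] by auto
    have "\<bar>height (w n) x - height (w n) y\<bar> \<le> \<bar>x - y\<bar> \<and>
        \<bar>zstate2 (u n) x - zstate2 (u n) y\<bar> \<le> \<bar>zstate2 (cap T) x - zstate2 (cap T) y\<bar>"
      using h[of x y] h[of y x] y assms(4) by (cases "x \<le> y") (auto simp: abs_minus_commute)
    moreover have "\<bar>zstate2 (cap T) x - zstate2 (cap T) y\<bar> < e / 2"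
      using d(2)[of y] y by (simp add: dist_real_def abs_minus_commute)
    moreover have "\<bar>x - y\<bar> < e / 2" using y by simp
    ultimately have "\<bar>height (w n) x - height (w n) y\<bar> + \<bar>zstate2 (u n) x - zstate2 (u n) y\<bar> < e" by linarith
    moreover have "norm ((height (w n) x, zstate2 (u n) x) - (height (w n) y, zstate2 (u n) y))
      \<le> \<bar>height (w n) x - height (w n) y\<bar> + \<bar>zstate2 (u n) x - zstate2 (u n) y\<bar>"
      using norm_Pair_le[of "height (w n) x - height (w n) y" "zstate2 (u n) x - zstate2 (u n) y"] by simp
    ultimately show ?thesis by linarith
  qed
  then show ?thesis using d(1) assms(3) by (intro exI[of _ "min d (e / 2)"]) auto
qed

lemma uniformly_convergent_states:
  assumes w: "\<And>n. incline (w n)" and u: "\<And>n. capped (u n)"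
  obtains y z :: "real \<Rightarrow> real" and k :: "nat \<Rightarrow> nat" where "strict_mono k" "continuous_on {0..T} z"
    "\<And>e. 0 < e \<Longrightarrow> \<exists>N. \<forall>n\<ge>N. \<forall>t\<in>{0..T}.
       \<bar>height (w (k n)) t - y t\<bar> < e \<and> \<bar>zstate2 (u (k n)) t - z t\<bar> < e"
proof -
  \<comment> \<open>Pairing the two states lets a single use of Arzela-Ascoli give a common
    subsequence. The bound \<open>7 * T\<close> is \<open>T\<close> for the height plus
    \<open>6 * T\<close> for the tail.\<close>
  define F where "F n t = (height (w n) t, zstate2 (u n) t)" for n t
  have bd: "norm (F n t) \<le> 7 * T" if "t \<in> {0..T}" for n t
  proof -
    have "norm (F n t) \<le> \<bar>height (w n) t\<bar> + \<bar>zstate2 (u n) t\<bar>"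
      using norm_Pair_le[of "height (w n) t" "zstate2 (u n) t"] by (simp add: F_def)
    moreover have "0 \<le> height (w n) t" "height (w n) t \<le> T"
      using height_nonneg[OF w] height_diff(2)[OF w, of 0 t n] that by (auto simp: height_0)
    ultimately show ?thesis
      using zstate_nonneg[OF capped_density[OF u], of n t] zstate_capped_le[OF u, of n t] by simp
  qed
  obtain G k where G: "continuous_on {0..T} G" "strict_mono (k :: nat \<Rightarrow> nat)"
    "\<And>e. 0 < e \<Longrightarrow> \<exists>N. \<forall>n x. n \<ge> N \<and> x \<in> {0..T} \<longrightarrow> norm (F (k n) x - G x) < e"
    using Arzela_Ascoli[of "{0..T}" F "7 * T"] bd equicontinuous_states[OF w u]
    unfolding F_def by (metis (no_types, lifting) compact_Icc)
  show thesis
  proof (rule that[of k "\<lambda>t. snd (G t)" "\<lambda>t. fst (G t)"])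
    show "continuous_on {0..T} (\<lambda>t. snd (G t))" using G(1) by (intro continuous_on_snd)
    fix e :: real assume "0 < e"
    then obtain N where N: "\<And>n x. n \<ge> N \<Longrightarrow> x \<in> {0..T} \<Longrightarrow> norm (F (k n) x - G x) < e"
      using G(3) by blast
    have "\<bar>height (w (k n)) t - fst (G t)\<bar> < e \<and> \<bar>zstate2 (u (k n)) t - snd (G t)\<bar> < e"
      if "n \<ge> N" "t \<in> {0..T}" for n t
      using N[OF that] dist_fst_le[of "F (k n) t" "G t"] dist_snd_le[of "F (k n) t" "G t"]
      by (auto simp: F_def dist_norm)
    then show "\<exists>N. \<forall>n\<ge>N. \<forall>t\<in>{0..T}.
       \<bar>height (w (k n)) t - fst (G t)\<bar> < e \<and> \<bar>zstate2 (u (k n)) t - snd (G t)\<bar> < e"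
      by blast
  qed (rule G(2))
qed

text \<open>Since \<open>y\<close> is strictly increasing, it meets the countably many discontinuities of \<open>I\<close> only on a null set.\<close>
lemma intensity_tendsto:
  assumes w: "\<And>n. incline (w n)"
    and "\<forall>t\<in>{0..T}. (\<lambda>n. height (w n) t) \<longlonglongrightarrow> y t"
  shows "AE t in lebesgue_on {0..T}. (\<lambda>n. I (height (w n) t)) \<longlonglongrightarrow> I (y t)"
    and "mono_on {0..T} (\<lambda>t. I (y t))" and "\<And>t. t \<in> {0..T} \<Longrightarrow> 0 \<le> y t"
proof -
  note lim = assms(2)[rule_format]
  \<comment> \<open>A quantitative growth rate passes to the limit, where strict monotonicity alone
    could be lost.\<close>
  have inc: "sin \<theta>0 * (t - s) \<le> y t - y s" if "0 \<le> s" "s \<le> t" "t \<le> T" for s t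
    using that height_diff(1)[OF w that(1,2)]
    by (intro LIMSEQ_le[OF tendsto_const tendsto_diff[OF lim lim]]) auto
  show y0: "0 \<le> y t" if "t \<in> {0..T}" for t
    using that height_nonneg[OF w] by (intro LIMSEQ_le[OF tendsto_const lim]) auto
  have "y s \<le> y t" if "0 \<le> s" "s \<le> t" "t \<le> T" for s t
  proof -
    have "0 \<le> sin \<theta>0 * (t - s)" using that sin_pos by simp
    then show ?thesis using inc[OF that] by linarith
  qed
  then show "mono_on {0..T} (\<lambda>t. I (y t))"
    using y0 by (intro mono_onI mono_onD[OF Imono]) auto
  have inj: "inj_on y {0..T}"
  proof (rule linorder_inj_onI')
    fix s t assume st: "s \<in> {0..T}" "t \<in> {0..T}" "s < t"
    then have "0 < sin \<theta>0 * (t - s)" using sin_pos by simp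
    then show "y s \<noteq> y t" using inc[of s t] st by auto
  qed
  define B where "B = {t \<in> {0..T}. \<not> continuous (at (y t) within {0..}) I}"
  have "countable {a \<in> {0..}. \<not> continuous (at a within {0..}) I}"
    by (rule mono_on_ctble_discont[OF Imono])
  then have "countable (y ` B)"
    by (rule countable_subset[rotated]) (use y0 in \<open>auto simp: B_def\<close>)
  then have "countable B"
    by (rule countable_image_inj_on) (rule inj_on_subset[OF inj], auto simp: B_def)
  then have "B \<in> null_sets lebesgue" by (intro null_sets_completionI countable_imp_null_set_lborel)
  then have "AE t in lebesgue. t \<notin> B" by (rule AE_not_in)
  then have "AE t in lebesgue_on {0..T}. t \<notin> B"
    by (subst AE_restrict_space_iff) (auto elim: eventually_mono)
  moreover have "AE t in lebesgue_on {0..T}. t \<in> {0..T}" by (intro AE_I2) simp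
  ultimately show "AE t in lebesgue_on {0..T}. (\<lambda>n. I (height (w n) t)) \<longlonglongrightarrow> I (y t)"
  proof eventually_elim
    case t: (elim t)
    then have c: "continuous (at (y t) within {0..}) I" by (simp add: B_def)
    show "(\<lambda>n. I (height (w n) t)) \<longlonglongrightarrow> I (y t)"
      using t height_nonneg[OF w] by (intro continuous_within_tendsto_compose'[OF c _ lim]) auto
  qed
qed

section \<open>Midpoints of controls\<close>

lemma incline_midpoint:
  assumes "incline a" "incline b"
  shows "incline (\<lambda>t. (a t + b t) / 2)"
proof -
  have "sin \<theta>0 \<le> (a t + b t) / 2" "(a t + b t) / 2 \<le> 1" for t
    using inclineD(2,3)[OF assms(1), of t] inclineD(2,3)[OF assms(2), of t] by auto
  then show ?thesis using inclineD(1)[OF assms(1)] inclineD(1)[OF assms(2)] by (auto simp: incline_def)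
qed

lemma capped_midpoint:
  assumes "capped a" "capped b"
  shows "capped (\<lambda>t. (a t + b t) / 2)"
proof -
  have "(a t + b t) / 2 \<le> cap T t" for t
  proof -
    have "a t \<le> cap T t" "b t \<le> cap T t" using assms by (auto simp: capped_def)
    then show ?thesis by simp
  qed
  then show ?thesis using assms by (auto simp: capped_def)
qed

lemma height_midpoint:
  assumes "incline a" "incline b"
  shows "height (\<lambda>t. (a t + b t) / 2) t = (height a t + height b t) / 2"
  unfolding height_def
  using incline_set_integrable[OF assms(1)] incline_set_integrable[OF assms(2)] by (simp add: set_integral_add)

lemma zstate_midpoint:
  assumes "density a" "density b"
  shows "zstate2 (\<lambda>t. (a t + b t) / 2) t = (zstate2 a t + zstate2 b t) / 2"
  unfolding zstate2_def
  using density_tail_integrable[OF assms(1), of "{t..}"] density_tail_integrable[OF assms(2), of "{t..}"]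
  by (simp add: set_integral_add)

lemma weighted_gain_integrable:
  assumes "incline w" "capped u"
    and R: "R \<in> borel_measurable (lebesgue_on {0..T})" "\<forall>t\<in>{0..T}. 0 \<le> R t \<and> R t \<le> 1"
  shows "integrable (lebesgue_on {0..T}) (\<lambda>t. R t * gain w u t)"
proof -
  interpret finite_measure "lebesgue_on {0..T}" by (rule finite_measure_interval)
  show ?thesis
  proof (rule integrable_const_bound[where B = 1])
    show "(\<lambda>t. R t * gain w u t) \<in> borel_measurable (lebesgue_on {0..T})"
      using R(1) restrict_lebesgue[OF gain_measurable_on[OF assms(1) capped_density[OF assms(2)]]]
      by (intro borel_measurable_times)
    show "AE t in lebesgue_on {0..T}. norm (R t * gain w u t) \<le> 1"
      using R(2) gain_bounds[OF assms(1) capped_density[OF assms(2)]]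
      by (intro AE_I2) (auto simp: abs_mult intro!: mult_le_one)
  qed
qed

text \<open>The pointwise concavity of the gain integrates because the weight \<open>R\<close> is
  the same for both controls; a weight \<open>I (height w t)\<close> would vary with the
  control.\<close>

lemma weighted_gain_midpoint:
  assumes a: "incline a" "incline b" and u: "capped u" "capped v"
    and R: "R \<in> borel_measurable (lebesgue_on {0..T})" "\<forall>t\<in>{0..T}. 0 \<le> R t \<and> R t \<le> 1"
  shows "((\<integral>t. R t * gain a u t \<partial>lebesgue_on {0..T}) + (\<integral>t. R t * gain b v t \<partial>lebesgue_on {0..T})) / 2
    \<le> (\<integral>t. R t * gain (\<lambda>t. (a t + b t) / 2) (\<lambda>t. (u t + v t) / 2) t \<partial>lebesgue_on {0..T})"
proof -
  note i = weighted_gain_integrable[OF _ _ R]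
  have "((\<integral>t. R t * gain a u t \<partial>lebesgue_on {0..T}) + (\<integral>t. R t * gain b v t \<partial>lebesgue_on {0..T})) / 2
     = (\<integral>t. (R t * gain a u t + R t * gain b v t) / 2 \<partial>lebesgue_on {0..T})"
    using i[OF a(1) u(1)] i[OF a(2) u(2)] by simp
  also have "\<dots> \<le> (\<integral>t. R t * gain (\<lambda>t. (a t + b t) / 2) (\<lambda>t. (u t + v t) / 2) t \<partial>lebesgue_on {0..T})"
  proof (rule integral_mono)
    show "integrable (lebesgue_on {0..T}) (\<lambda>t. (R t * gain a u t + R t * gain b v t) / 2)"
      using i[OF a(1) u(1)] i[OF a(2) u(2)] by simp
    show "integrable (lebesgue_on {0..T}) (\<lambda>t. R t * gain (\<lambda>t. (a t + b t) / 2) (\<lambda>t. (u t + v t) / 2) t)"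
      by (intro i incline_midpoint capped_midpoint a u)
    fix t assume "t \<in> space (lebesgue_on {0..T})"
    then have "0 \<le> R t" using R(2) by auto
    moreover have "(gain a u t + gain b v t) / 2 \<le> gain (\<lambda>t. (a t + b t) / 2) (\<lambda>t. (u t + v t) / 2) t"
      unfolding gain_def
      using gain_midpoint[OF th0 inclineD(2,3)[OF a(1)] inclineD(2,3)[OF a(2)]] .
    ultimately have "R t * ((gain a u t + gain b v t) / 2) \<le> R t * gain (\<lambda>t. (a t + b t) / 2) (\<lambda>t. (u t + v t) / 2) t"
      by (intro mult_left_mono)
    then show "(R t * gain a u t + R t * gain b v t) / 2 \<le> R t * gain (\<lambda>t. (a t + b t) / 2) (\<lambda>t. (u t + v t) / 2) t"
      by (simp add: algebra_simps)
  qed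
  finally show ?thesis .
qed

lemma limit_control:
  fixes y z R :: "real \<Rightarrow> real" and \<sigma> :: real
  assumes R: "R \<in> borel_measurable (lebesgue_on {0..T})" "\<forall>t\<in>{0..T}. 0 \<le> R t \<and> R t \<le> 1"
    and approx: "\<forall>e>0. \<exists>w u. incline w \<and> capped u \<and>
      (\<forall>t\<in>{0..T}. \<bar>height w t - y t\<bar> \<le> e \<and> \<bar>zstate2 u t - z t\<bar> \<le> e) \<and>
      \<sigma> - e \<le> (\<integral>t. R t * gain w u t \<partial>lebesgue_on {0..T})"
  obtains w u where "incline w" "capped u" "\<And>t. t \<in> {0..T} \<Longrightarrow> height w t = y t"
    "\<And>t. t \<in> {0..T} \<Longrightarrow> zstate2 u t = z t" "\<sigma> \<le> (\<integral>t. R t * gain w u t \<partial>lebesgue_on {0..T})"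
proof -
  let ?M = "lebesgue_on {0..T}"
  interpret finite_measure ?M by (rule finite_measure_interval)
  define \<epsilon> where "\<epsilon> n = 1 / (real n + 1)" for n
  have \<epsilon>: "0 < \<epsilon> n" for n by (simp add: \<epsilon>_def)
  have \<epsilon>0: "\<epsilon> \<longlonglongrightarrow> 0" unfolding \<epsilon>_def using LIMSEQ_inverse_real_of_nat by (simp add: inverse_eq_divide add.commute)
  \<comment> \<open>A control is treated as one function into the plane, so that both components
    converge along the same sequence.\<close>
  define P where "P e f \<longleftrightarrow> incline (\<lambda>t. fst (f t)) \<and> capped (\<lambda>t. snd (f t)) \<and>
      (\<forall>t\<in>{0..T}. \<bar>height (\<lambda>t. fst (f t)) t - y t\<bar> \<le> e \<and> \<bar>zstate2 (\<lambda>t. snd (f t)) t - z t\<bar> \<le> e) \<and>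
      \<sigma> - e \<le> (\<integral>t. R t * gain (\<lambda>t. fst (f t)) (\<lambda>t. snd (f t)) t \<partial>?M)"
    for e and f :: "real \<Rightarrow> real \<times> real"
  define C where "C n = {f. P (\<epsilon> n) f}" for n
  have "\<exists>g G. (\<forall>n. g n \<in> C n) \<and> G \<in> borel_measurable ?M \<and> (AE t in ?M. (\<lambda>n. g n t) \<longlonglongrightarrow> G t)"
  proof (rule midpoint_closed_AE_convergent[of C "\<lambda>t. 1 + (cap T t)\<^sup>2"])
    show "decseq C"
    proof (rule decseq_SucI, rule subsetI)
      fix n f assume "f \<in> C (Suc n)"
      moreover have "\<epsilon> (Suc n) \<le> \<epsilon> n" by (simp add: \<epsilon>_def frac_le)
      ultimately show "f \<in> C n" unfolding C_def P_def by fastforce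
    qed
    show "C n \<noteq> {}" for n
    proof -
      obtain w u where "incline w" "capped u"
        "\<forall>t\<in>{0..T}. \<bar>height w t - y t\<bar> \<le> \<epsilon> n \<and> \<bar>zstate2 u t - z t\<bar> \<le> \<epsilon> n"
        "\<sigma> - \<epsilon> n \<le> (\<integral>t. R t * gain w u t \<partial>?M)"
        using approx[rule_format, OF \<epsilon>[of n]] by blast
      then have "(\<lambda>t. (w t, u t)) \<in> C n" by (simp add: C_def P_def)
      then show ?thesis by blast
    qed
    show "(\<lambda>x. (1/2) *\<^sub>R (f x + g x)) \<in> C n" if "f \<in> C n" "g \<in> C n" for n f g
    proof -
      define a b u v where "a = (\<lambda>t. fst (f t))" "b = (\<lambda>t. fst (g t))" "u = (\<lambda>t. snd (f t))" "v = (\<lambda>t. snd (g t))"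
      note d = this
      have f: "incline a" "capped u" "\<And>t. t \<in> {0..T} \<Longrightarrow> \<bar>height a t - y t\<bar> \<le> \<epsilon> n"
        "\<And>t. t \<in> {0..T} \<Longrightarrow> \<bar>zstate2 u t - z t\<bar> \<le> \<epsilon> n" "\<sigma> - \<epsilon> n \<le> (\<integral>t. R t * gain a u t \<partial>?M)"
        using that(1) by (auto simp: C_def P_def d)
      have g: "incline b" "capped v" "\<And>t. t \<in> {0..T} \<Longrightarrow> \<bar>height b t - y t\<bar> \<le> \<epsilon> n"
        "\<And>t. t \<in> {0..T} \<Longrightarrow> \<bar>zstate2 v t - z t\<bar> \<le> \<epsilon> n" "\<sigma> - \<epsilon> n \<le> (\<integral>t. R t * gain b v t \<partial>?M)"
        using that(2) by (auto simp: C_def P_def d)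
      have "\<sigma> - \<epsilon> n \<le> (\<integral>t. R t * gain (\<lambda>t. (a t + b t) / 2) (\<lambda>t. (u t + v t) / 2) t \<partial>?M)"
        by (rule le_of_midpoint_le[OF f(5) g(5) weighted_gain_midpoint[OF f(1) g(1) f(2) g(2) R]])
      moreover have "\<bar>height (\<lambda>t. (a t + b t) / 2) t - y t\<bar> \<le> \<epsilon> n" if "t \<in> {0..T}" for t
        unfolding height_midpoint[OF f(1) g(1)] by (rule abs_midpoint_le[OF f(3)[OF that] g(3)[OF that]])
      moreover have "\<bar>zstate2 (\<lambda>t. (u t + v t) / 2) t - z t\<bar> \<le> \<epsilon> n" if "t \<in> {0..T}" for t
        unfolding zstate_midpoint[OF capped_density[OF f(2)] capped_density[OF g(2)]]
        by (rule abs_midpoint_le[OF f(4)[OF that] g(4)[OF that]])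
      ultimately have "P (\<epsilon> n) (\<lambda>t. ((a t + b t) / 2, (u t + v t) / 2))"
        unfolding P_def fst_conv snd_conv
        by (intro conjI ballI incline_midpoint capped_midpoint f g)
      moreover have "(\<lambda>t. ((a t + b t) / 2, (u t + v t) / 2)) = (\<lambda>x. (1/2) *\<^sub>R (f x + g x))"
        by (auto simp: d fun_eq_iff prod_eq_iff)
      ultimately show ?thesis by (simp add: C_def)
    qed
    show "f \<in> borel_measurable ?M" if "f \<in> C n" for n f
    proof -
      have [measurable]: "(\<lambda>t. fst (f t)) \<in> borel_measurable ?M" "(\<lambda>t. snd (f t)) \<in> borel_measurable ?M"
        using that by (auto intro!: restrict_lebesgue simp: C_def P_def incline_def capped_def)
      have "(\<lambda>t. (fst (f t), snd (f t))) \<in> borel_measurable ?M" by measurable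
      then show ?thesis by simp
    qed
    show "(norm (f t))\<^sup>2 \<le> 1 + (cap T t)\<^sup>2" if "f \<in> C n" for n f t
    proof -
      have "incline (\<lambda>t. fst (f t))" "capped (\<lambda>t. snd (f t))" using that by (auto simp: C_def P_def)
      note b = inclineD(3,4)[OF this(1), of t] this(2)
      have "(norm (f t))\<^sup>2 = (fst (f t))\<^sup>2 + (snd (f t))\<^sup>2"
        by (cases "f t") (simp add: norm_Pair)
      moreover have "(fst (f t))\<^sup>2 \<le> 1" using b by (simp add: power_le_one)
      moreover have "(snd (f t))\<^sup>2 \<le> (cap T t)\<^sup>2" using b(3) by (intro power_mono) (auto simp: capped_def)
      ultimately show ?thesis by linarith
    qed
    \<comment> \<open>This is where the square integrability built into the cap enters.\<close>
    have "integrable ?M (\<lambda>t. (cap T t)\<^sup>2)"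
      using cap_square_integrable[OF T0]
      by (subst integrable_restrict_space) (auto intro!: integrable_mult_indicator[where 'b = real, simplified])
    then show "integrable ?M (\<lambda>t. 1 + (cap T t)\<^sup>2)" by simp
  qed blast
  then obtain g G where gC: "\<And>n. g n \<in> C n" and Gm: "G \<in> borel_measurable ?M"
    and lim: "AE t in ?M. (\<lambda>n. g n t) \<longlonglongrightarrow> G t" by blast
  define wn un where "wn n t = fst (g n t)" and "un n t = snd (g n t)" for n t
  have wn: "incline (wn n)" and un: "capped (un n)"
    and near: "\<And>t. t \<in> {0..T} \<Longrightarrow> \<bar>height (wn n) t - y t\<bar> \<le> \<epsilon> n"
      "\<And>t. t \<in> {0..T} \<Longrightarrow> \<bar>zstate2 (un n) t - z t\<bar> \<le> \<epsilon> n"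
    and val: "\<sigma> - \<epsilon> n \<le> (\<integral>t. R t * gain (wn n) (un n) t \<partial>?M)" for n
    using gC[of n] by (auto simp: C_def P_def wn_def[abs_def] un_def[abs_def])
  \<comment> \<open>The limit \<open>G\<close> obeys the control bounds only almost everywhere.
    Clamping enforces them at every time and changes nothing where the sequence converges.\<close>
  define w where "w t = (if t \<in> {0..T} then max (sin \<theta>0) (min 1 (fst (G t))) else 1)" for t
  define u where "u t = (if t \<in> {0..T} then max 0 (min (cap T t) (snd (G t))) else 0)" for t
  have [measurable]: "(\<lambda>t. fst (G t)) \<in> borel_measurable ?M" "(\<lambda>t. snd (G t)) \<in> borel_measurable ?M"
    by (rule measurable_compose[OF Gm borel_measurable_continuous_onI], intro continuous_intros)+
  have [measurable]: "cap T \<in> borel_measurable ?M"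
    using cap_integrable(1)[OF T0] by (intro restrict_lebesgue) auto
  have w: "incline w"
    unfolding incline_def
  proof (intro conjI allI)
    have "(\<lambda>t. max (sin \<theta>0) (min 1 (fst (G t)))) \<in> borel_measurable ?M" by measurable
    then show "w \<in> borel_measurable lebesgue"
      unfolding w_def[abs_def] by (subst (asm) measurable_restrict_space_iff[where c = 1]) auto
  qed (auto simp: w_def)
  have u: "capped u"
    unfolding capped_def
  proof (intro conjI allI)
    have "(\<lambda>t. max 0 (min (cap T t) (snd (G t)))) \<in> borel_measurable ?M" by measurable
    then show "u \<in> borel_measurable lebesgue"
      unfolding u_def[abs_def] by (subst (asm) measurable_restrict_space_iff[where c = 0]) auto
  qed (auto simp: u_def cap_nonneg)
  have inM: "AE t in ?M. t \<in> {0..T}" by (intro AE_I2) simp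
  have limw: "AE t in ?M. (\<lambda>n. wn n t) \<longlonglongrightarrow> w t"
    using lim inM
  proof eventually_elim
    case (elim t)
    have l: "(\<lambda>n. wn n t) \<longlonglongrightarrow> fst (G t)" unfolding wn_def using elim by (intro tendsto_fst)
    have "sin \<theta>0 \<le> fst (G t)" using inclineD(2)[OF wn] by (intro LIMSEQ_le_const[OF l]) auto
    moreover have "fst (G t) \<le> 1" using inclineD(3)[OF wn] by (intro LIMSEQ_le_const2[OF l]) auto
    ultimately show ?case using l elim by (simp add: w_def)
  qed
  have limu: "AE t in ?M. (\<lambda>n. un n t) \<longlonglongrightarrow> u t"
    using lim inM
  proof eventually_elim
    case (elim t)
    have l: "(\<lambda>n. un n t) \<longlonglongrightarrow> snd (G t)" unfolding un_def using elim by (intro tendsto_snd)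
    have "0 \<le> snd (G t)" using un by (intro LIMSEQ_le_const[OF l]) (auto simp: capped_def)
    moreover have "snd (G t) \<le> cap T t" using un by (intro LIMSEQ_le_const2[OF l]) (auto simp: capped_def)
    ultimately show ?case using l elim by (simp add: u_def)
  qed
  show thesis
  proof (rule that[OF w u])
    fix t assume t: "t \<in> {0..T}"
    have "(\<lambda>n. height (wn n) t - y t) \<longlonglongrightarrow> 0"
      using near(1)[OF t] by (intro Lim_null_comparison[OF _ \<epsilon>0]) auto
    then have "(\<lambda>n. height (wn n) t) \<longlonglongrightarrow> y t" by (simp add: LIM_zero_iff)
    then show "height w t = y t" using height_tendsto[OF wn w limw t] by (rule LIMSEQ_unique[rotated])
    have "(\<lambda>n. zstate2 (un n) t - z t) \<longlonglongrightarrow> 0"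
      using near(2)[OF t] by (intro Lim_null_comparison[OF _ \<epsilon>0]) auto
    then have "(\<lambda>n. zstate2 (un n) t) \<longlonglongrightarrow> z t" by (simp add: LIM_zero_iff)
    then show "zstate2 u t = z t" using zstate_tendsto[OF un u limu] by (rule LIMSEQ_unique[rotated])
  next
    have "(\<lambda>n. \<sigma> - \<epsilon> n) \<longlonglongrightarrow> \<sigma> - 0" by (intro tendsto_diff tendsto_const \<epsilon>0)
    from LIMSEQ_le[OF this weighted_gain_tendsto[OF wn w un u limw limu R]]
    have "\<sigma> - 0 \<le> (\<integral>t. R t * gain w u t \<partial>?M)" using val by blast
    then show "\<sigma> \<le> (\<integral>t. R t * gain w u t \<partial>?M)" by simp
  qed
qed

lemma reduced_value_le:
  assumes w: "incline w" and u: "capped u"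
  shows "reduced_value w u \<le> T"
proof -
  interpret finite_measure "lebesgue_on {0..T}" by (rule finite_measure_interval)
  note ud = capped_density[OF u]
  have m: "(\<lambda>t. I (height w t)) \<in> borel_measurable (lebesgue_on {0..T})"
    by (intro intensity_measurable w) auto
  have "(\<integral>t. I (height w t) * gain w u t \<partial>lebesgue_on {0..T}) \<le> (\<integral>t. 1 \<partial>lebesgue_on {0..T})"
  proof (rule integral_mono)
    show "integrable (lebesgue_on {0..T}) (\<lambda>t. I (height w t) * gain w u t)"
      using I01 height_nonneg[OF w] by (intro weighted_gain_integrable[OF w u m]) auto
    show "I (height w t) * gain w u t \<le> 1" if "t \<in> space (lebesgue_on {0..T})" for t
      using reward_bounds(2)[OF w ud, of t] gain_bounds(2)[OF w ud, of t] that by auto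
  qed simp
  moreover have "(\<integral>t. 1 \<partial>lebesgue_on {0..T}) = T"
    using T0 by (simp add: measure_restrict_space measure_completion)
  moreover have "0 \<le> (\<integral>t. cost u t \<partial>lebesgue_on {0..T})"
    using cost_nonneg by (intro Bochner_Integration.integral_nonneg) auto
  ultimately show ?thesis by (simp add: reduced_value_def)
qed

text \<open>Along a maximising sequence the weights and the costs converge on their own, so the
  weighted gains tend to \<open>\<sigma>\<close>. A control with exactly the limiting states and
  weighted gain at least \<open>\<sigma>\<close> attains the supremum.\<close>

lemma reduced_maximizer:
  obtains w u where "incline w" "capped u"
    "\<And>w' u'. incline w' \<Longrightarrow> capped u' \<Longrightarrow> reduced_value w' u' \<le> reduced_value w u"
proof -
  let ?M = "lebesgue_on {0..T}"
  interpret finite_measure ?M by (rule finite_measure_interval)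
  define V where "V = {reduced_value w u | w u. incline w \<and> capped u}"
  define S where "S = Sup V"
  have "incline (\<lambda>_. 1)" "capped (\<lambda>_. 0)" by (auto simp: incline_def capped_def cap_nonneg)
  then have Vne: "V \<noteq> {}" unfolding V_def by blast
  have bdd: "bdd_above V" using reduced_value_le by (intro bdd_aboveI[of _ T]) (auto simp: V_def)
  have le_S: "reduced_value w u \<le> S" if "incline w" "capped u" for w u
    unfolding S_def using bdd that by (intro cSup_upper) (auto simp: V_def)
  have "\<exists>w u. incline w \<and> capped u \<and> S - 1 / (real n + 1) < reduced_value w u" for n
    using less_cSup_iff[OF Vne bdd, of "S - 1 / (real n + 1)"] by (auto simp: V_def S_def)
  then obtain w u where w: "\<And>n. incline (w n)" and u: "\<And>n. capped (u n)"
    and max: "\<And>n. S - 1 / (real n + 1) < reduced_value (w n) (u n)" by metis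
  have l: "(\<lambda>n. S - 1 / (real n + 1)) \<longlonglongrightarrow> S - 0"
    using LIMSEQ_inverse_real_of_nat by (intro tendsto_diff tendsto_const) (simp add: inverse_eq_divide add.commute)
  have rvS: "(\<lambda>n. reduced_value (w n) (u n)) \<longlonglongrightarrow> S"
    by (rule tendsto_sandwich[OF _ _ l[simplified] tendsto_const])
      (auto intro!: always_eventually less_imp_le[OF max] le_S[OF w u])
  obtain y z k where k: "strict_mono (k :: nat \<Rightarrow> nat)" and zc: "continuous_on {0..T} z"
    and unif: "\<And>e. 0 < e \<Longrightarrow> \<exists>N. \<forall>n\<ge>N. \<forall>t\<in>{0..T}.
       \<bar>height (w (k n)) t - y t\<bar> < e \<and> \<bar>zstate2 (u (k n)) t - z t\<bar> < e"
    by (rule uniformly_convergent_states[of w u, OF w u]) (rule that)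
  define wk uk where "wk n = w (k n)" and "uk n = u (k n)" for n
  have wk: "incline (wk n)" and uk: "capped (uk n)" for n using w u by (auto simp: wk_def uk_def)
  have rvk: "(\<lambda>n. reduced_value (wk n) (uk n)) \<longlonglongrightarrow> S"
    using LIMSEQ_subseq_LIMSEQ[OF rvS k] by (simp add: o_def wk_def uk_def)
  have limy: "\<forall>t\<in>{0..T}. (\<lambda>n. height (wk n) t) \<longlonglongrightarrow> y t"
    and limz: "\<forall>t\<in>{0..T}. (\<lambda>n. zstate2 (uk n) t) \<longlonglongrightarrow> z t"
    unfolding LIMSEQ_def dist_real_def wk_def uk_def using unif by meson+
  define R where "R t = I (y t)" for t
  note lh = intensity_tendsto[OF wk limy]
  have R: "R \<in> borel_measurable ?M" "\<forall>t\<in>{0..T}. 0 \<le> R t \<and> R t \<le> 1"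
    using mono_on_measurable_lebesgue_on[OF lh(2)] lh(3) I01 by (auto simp: R_def[abs_def])
  \<comment> \<open>The gain that must remain in the limit: the supremum plus the limiting
    cost.\<close>
  define \<sigma> where "\<sigma> = S + (\<integral>t. c * z t powr \<alpha> \<partial>?M)"
  have zm: "z \<in> borel_measurable ?M"
    using zc by (intro continuous_imp_measurable_on_sets_lebesgue) auto
  have costs: "(\<lambda>n. \<integral>t. cost (uk n) t \<partial>?M) \<longlonglongrightarrow> (\<integral>t. c * z t powr \<alpha> \<partial>?M)"
  proof (rule integral_dominated_convergence[where w = "\<lambda>_. c * (6 * T) powr \<alpha>"])
    show "(\<lambda>t. c * z t powr \<alpha>) \<in> borel_measurable ?M" using zm by measurable
    show "cost (uk n) \<in> borel_measurable ?M" for n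
      by (rule restrict_lebesgue[OF cost_measurable[OF capped_density[OF uk]]])
    show "AE t in ?M. (\<lambda>n. cost (uk n) t) \<longlonglongrightarrow> c * z t powr \<alpha>"
    proof (intro AE_I2)
      fix t assume "t \<in> space ?M"
      then have "(\<lambda>n. zstate2 (uk n) t) \<longlonglongrightarrow> z t" using limz by simp
      then show "(\<lambda>n. cost (uk n) t) \<longlonglongrightarrow> c * z t powr \<alpha>"
        unfolding cost_def using al zstate_nonneg[OF capped_density[OF uk]]
        by (intro tendsto_mult_left tendsto_powr') auto
    qed
    show "AE t in ?M. norm (cost (uk n) t) \<le> c * (6 * T) powr \<alpha>" for n
      using cost_capped_le[OF uk] cost_nonneg by (intro AE_I2) auto
  qed simp
  have Im: "(\<lambda>t. I (height (wk n) t)) \<in> borel_measurable ?M" for n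
    by (intro intensity_measurable wk) auto
  have I1: "\<forall>t\<in>{0..T}. 0 \<le> I (height (wk n) t) \<and> I (height (wk n) t) \<le> 1" for n
    using I01 height_nonneg[OF wk] by auto
  \<comment> \<open>Freezing the weight at \<open>R\<close> changes the weighted gain by a vanishing
    amount, because gains are at most \<open>1\<close>.\<close>
  have swap: "(\<lambda>n. \<integral>t. (R t - I (height (wk n) t)) * gain (wk n) (uk n) t \<partial>?M) \<longlonglongrightarrow> (\<integral>t. 0 \<partial>?M)"
  proof (rule integral_dominated_convergence[where w = "\<lambda>_. 1"])
    show "(\<lambda>t. (R t - I (height (wk n) t)) * gain (wk n) (uk n) t) \<in> borel_measurable ?M" for n
      using R(1) Im restrict_lebesgue[OF gain_measurable_on[OF wk capped_density[OF uk]]]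
      by (intro borel_measurable_times borel_measurable_diff)
    have gb: "0 \<le> gain (wk n) (uk n) t" "gain (wk n) (uk n) t \<le> 1" for n t
      using gain_bounds[OF wk capped_density[OF uk]] by auto
    show "AE t in ?M. norm ((R t - I (height (wk n) t)) * gain (wk n) (uk n) t) \<le> 1" for n
    proof (intro AE_I2)
      fix t assume "t \<in> space ?M"
      then have "\<bar>R t - I (height (wk n) t)\<bar> \<le> 1" using R(2)[rule_format, of t] I1[of n, rule_format, of t] by auto
      then show "norm ((R t - I (height (wk n) t)) * gain (wk n) (uk n) t) \<le> 1"
        using gb[of n t] by (simp add: abs_mult mult_le_one)
    qed
    show "AE t in ?M. (\<lambda>n. (R t - I (height (wk n) t)) * gain (wk n) (uk n) t) \<longlonglongrightarrow> 0"
      using lh(1)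
    proof eventually_elim
      case (elim t)
      then have "(\<lambda>n. R t - I (height (wk n) t)) \<longlonglongrightarrow> R t - I (y t)"
        by (intro tendsto_diff tendsto_const)
      then have "(\<lambda>n. R t - I (height (wk n) t)) \<longlonglongrightarrow> 0" by (simp add: R_def)
      then have l0: "(\<lambda>n. \<bar>R t - I (height (wk n) t)\<bar>) \<longlonglongrightarrow> 0" by (rule tendsto_rabs_zero)
      have "norm ((R t - I (height (wk n) t)) * gain (wk n) (uk n) t) \<le> \<bar>R t - I (height (wk n) t)\<bar>" for n
        using mult_left_le[OF gb(2)[of n t] abs_ge_zero] gb(1)[of n t] by (simp add: abs_mult)
      then show ?case by (intro Lim_null_comparison[OF always_eventually l0] allI)
    qed
  qed simp_all
  have "(\<integral>t. R t * gain (wk n) (uk n) t \<partial>?M)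
     = reduced_value (wk n) (uk n) + (\<integral>t. cost (uk n) t \<partial>?M)
       + (\<integral>t. (R t - I (height (wk n) t)) * gain (wk n) (uk n) t \<partial>?M)" for n
  proof -
    have "(\<integral>t. (R t - I (height (wk n) t)) * gain (wk n) (uk n) t \<partial>?M)
      = (\<integral>t. R t * gain (wk n) (uk n) t \<partial>?M) - (\<integral>t. I (height (wk n) t) * gain (wk n) (uk n) t \<partial>?M)"
      unfolding left_diff_distrib
      by (intro Bochner_Integration.integral_diff weighted_gain_integrable wk uk R Im I1)
    then show ?thesis by (simp add: reduced_value_def)
  qed
  moreover have "(\<lambda>n. reduced_value (wk n) (uk n) + (\<integral>t. cost (uk n) t \<partial>?M)
       + (\<integral>t. (R t - I (height (wk n) t)) * gain (wk n) (uk n) t \<partial>?M)) \<longlonglongrightarrow> \<sigma> + (\<integral>t. 0 \<partial>?M)"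
    unfolding \<sigma>_def by (intro tendsto_add rvk costs swap)
  ultimately have lim\<sigma>: "(\<lambda>n. \<integral>t. R t * gain (wk n) (uk n) t \<partial>?M) \<longlonglongrightarrow> \<sigma>" by simp
  have approx: "\<forall>e>0. \<exists>w u. incline w \<and> capped u \<and>
      (\<forall>t\<in>{0..T}. \<bar>height w t - y t\<bar> \<le> e \<and> \<bar>zstate2 u t - z t\<bar> \<le> e) \<and>
      \<sigma> - e \<le> (\<integral>t. R t * gain w u t \<partial>?M)"
  proof (intro allI impI)
    fix e :: real assume "0 < e"
    obtain N where N: "\<And>n t. n \<ge> N \<Longrightarrow> t \<in> {0..T} \<Longrightarrow> \<bar>height (wk n) t - y t\<bar> < e \<and> \<bar>zstate2 (uk n) t - z t\<bar> < e"
      using unif[OF \<open>0 < e\<close>] unfolding wk_def uk_def by blast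
    have "\<forall>\<^sub>F n in sequentially. \<sigma> - e < (\<integral>t. R t * gain (wk n) (uk n) t \<partial>?M)"
      using \<open>0 < e\<close> by (intro order_tendstoD(1)[OF lim\<sigma>]) simp
    then obtain N' where N': "\<And>n. n \<ge> N' \<Longrightarrow> \<sigma> - e < (\<integral>t. R t * gain (wk n) (uk n) t \<partial>?M)"
      unfolding eventually_sequentially by blast
    define n where "n = max N N'"
    have "\<forall>t\<in>{0..T}. \<bar>height (wk n) t - y t\<bar> \<le> e \<and> \<bar>zstate2 (uk n) t - z t\<bar> \<le> e"
      using N[of n] by (auto simp: n_def intro: less_imp_le)
    moreover have "\<sigma> - e \<le> (\<integral>t. R t * gain (wk n) (uk n) t \<partial>?M)"
      by (rule less_imp_le[OF N']) (simp add: n_def)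
    ultimately show "\<exists>w u. incline w \<and> capped u \<and>
      (\<forall>t\<in>{0..T}. \<bar>height w t - y t\<bar> \<le> e \<and> \<bar>zstate2 u t - z t\<bar> \<le> e) \<and>
      \<sigma> - e \<le> (\<integral>t. R t * gain w u t \<partial>?M)"
      using wk[of n] uk[of n] by blast
  qed
  obtain w' u' where *: "incline w'" "capped u'" "\<And>t. t \<in> {0..T} \<Longrightarrow> height w' t = y t"
    "\<And>t. t \<in> {0..T} \<Longrightarrow> zstate2 u' t = z t" "\<sigma> \<le> (\<integral>t. R t * gain w' u' t \<partial>?M)"
    by (rule limit_control[OF R approx]) (rule that)
  have "(\<integral>t. I (height w' t) * gain w' u' t \<partial>?M) = (\<integral>t. R t * gain w' u' t \<partial>?M)"
    by (intro Bochner_Integration.integral_cong) (auto simp: R_def *)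
  moreover have "(\<integral>t. cost u' t \<partial>?M) = (\<integral>t. c * z t powr \<alpha> \<partial>?M)"
    by (intro Bochner_Integration.integral_cong) (auto simp: cost_def *)
  ultimately have "S \<le> reduced_value w' u'" using *(5) by (simp add: reduced_value_def \<sigma>_def)
  then show thesis using that[OF *(1,2)] le_S by (meson order_trans)
qed

text \<open>Every admissible value is bounded by a reduced value, and the largest reduced value is
  realised by the angle \<open>arcsin (w t)\<close>.\<close>

lemma optimal_exists: "\<exists>\<theta> u. optimal2 \<theta>0 \<alpha> c I \<theta> u"
proof -
  obtain w u where w: "incline w" and u: "capped u"
    and max: "\<And>w' u'. incline w' \<Longrightarrow> capped u' \<Longrightarrow> reduced_value w' u' \<le> reduced_value w u"
    by (rule reduced_maximizer) blast
  let ?\<theta> = "\<lambda>t. arcsin (w t)"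
  note a = reduced_control_admissible[OF w u]
  have "(SUP p\<in>{(\<theta>', u'). admissible2 \<theta>0 \<theta>' u'}. J2 \<theta>0 \<alpha> c I (fst p) (snd p)) = J2 \<theta>0 \<alpha> c I ?\<theta> u"
  proof (rule antisym)
    show "(SUP p\<in>{(\<theta>', u'). admissible2 \<theta>0 \<theta>' u'}. J2 \<theta>0 \<alpha> c I (fst p) (snd p)) \<le> J2 \<theta>0 \<alpha> c I ?\<theta> u"
    proof (rule SUP_least, clarsimp)
      fix \<theta> v assume "admissible2 \<theta>0 \<theta> v"
      then obtain w' u' where "incline w'" "capped u'" "J2 \<theta>0 \<alpha> c I \<theta> v \<le> ereal (reduced_value w' u')"
        by (rule reduce_admissible)
      then show "J2 \<theta>0 \<alpha> c I \<theta> v \<le> J2 \<theta>0 \<alpha> c I ?\<theta> u"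
        using max[of w' u'] unfolding a(2) by (meson ereal_less_eq(3) order_trans)
    qed
    show "J2 \<theta>0 \<alpha> c I ?\<theta> u \<le> (SUP p\<in>{(\<theta>', u'). admissible2 \<theta>0 \<theta>' u'}. J2 \<theta>0 \<alpha> c I (fst p) (snd p))"
      using a(1) by (intro SUP_upper2[of "(?\<theta>, u)"]) auto
  qed
  then show ?thesis using a(1) unfolding optimal2_def by metis
qed

end

theorem theorem5p1:
  fixes \<theta>0 \<alpha> c :: real and I :: "real \<Rightarrow> real"
  assumes "0 < \<theta>0" and "\<theta>0 < pi / 2"
    and "0 < \<alpha>" and "\<alpha> < 1" and "0 < c"
    and "\<forall>x\<ge>0. 0 \<le> I x \<and> I x \<le> 1"
    and "mono_on {0..} I"
  shows "\<exists>\<theta> u. optimal2 \<theta>0 \<alpha> c I \<theta> u"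
proof -
  \<comment> \<open>Since \<open>(7 * T) powr (\<alpha> - 1) * T = 7 powr (\<alpha> - 1) * T powr
    \<alpha>\<close>, the largeness condition of the locale reads
    \<open>2 \<le> k * T powr \<alpha>\<close>; \<open>T\<close> is chosen to give equality.\<close>
  define k where "k = c * (\<alpha> * 7 powr (\<alpha> - 1))"
  define T where "T = (2 / k) powr (1 / \<alpha>)"
  have k: "0 < k" using assms by (simp add: k_def)
  then have T: "0 < T" by (simp add: T_def)
  have "T powr (\<alpha> - 1) * T = T powr \<alpha>" using powr_mult_base[of T "\<alpha> - 1"] T by (simp add: mult.commute)
  also have "\<dots> = 2 / k" using assms k by (simp add: T_def powr_powr)
  finally have "k * (T powr (\<alpha> - 1) * T) = 2" using k by simp
  then have "2 \<le> c * (\<alpha> * (7 * T) powr (\<alpha> - 1)) * T" using T by (simp add: k_def powr_mult mult_ac)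
  then interpret stem \<theta>0 \<alpha> c I T using assms T by unfold_locales auto
  show ?thesis by (rule optimal_exists)
qed

end
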